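(* Assume the setting and Assumptions A1, A2, A3 in the context, and let $n\ge1$. Define the effective sample size \[ \ell^\star:=\max\Big(\Big\{1\le\ell\le n:\ C_1\,\Phi_{\mathcal C}\big(\lfloor n/\ell\rfloor\big)\le \frac{c}{\ell}\vee\frac{\sigma}{\sqrt\ell}\Big\}\cup\{1\}\Big). \] Then for every $\nu\ge1$, \[ \mathbb P\left(\Big\|\frac1n\sum_{i=1}^nX_i\Big\|\ \ge\ \frac{\sigma\,(4A_1+6\sqrt B\sqrt\nu)}{\sqrt{\ell^\star}}+\frac{c\,(4A_1+M_1\nu)}{\ell^\star}\right)\le 2e^{-\nu}, \] where $B=A_1^2+A_2$ and $M_1=2+2\sqrt B\big(1+2\frac{C_2}{C_1c}\big)$.
   Context: Let $(\mathcal B,\|\cdot\|)$ be a separable real Banach space with dual $\mathcal B^\star$ (dual norm $\|\cdot\|_\star$, duality pairing $\langle\cdot,\cdot\rangle$). For $r>0$ let $B(r)$ and $B^\star(r)$ denote the closed balls of radius $r$ centered at $0$ in $\mathcal B$ and $\mathcal B^\star$. Fix $c>0$ and put $\mathcal X=B(c)$. Let $(X_i)_{i\ge1}$ be a stochastic process on a probability space $(\Omega,\mathcal F,\mathbb P)$ with values in $\mathcal X$ which is centered ($\mathbb E X_i=0$ for all $i$, Bochner expectation). Let $\mathcal M_i=\sigma(X_1,\dots,X_i)$. $\mathcal C$-mixing: let $\mathcal C$ be a closed subspace of the Banach space of bounded real-valued functions on $\mathcal X$ (with the supremum norm), let $C(\cdot)$ be a seminorm on $\mathcal C$, and $\mathcal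 C_1=\{f\in\mathcal C: C(f)\le 1\}$. For integers $k\ge1$ the $\mathcal C$-mixing coefficients are $\Phi_{\mathcal C}(k)=\sup\{\|\mathbb E[\varphi(X_{i+k})\mid\mathcal M_i]-\mathbb E[\varphi(X_{i+k})]\|_{L_\infty(\mathbb P)}:\ \varphi\in\mathcal C_1,\ i\ge1\}$. Gâteaux derivatives: for $f:\mathcal B\to\mathbb R$, $x\in\mathcal B$, $v\in\mathcal B$, $\delta_v f(x)=\frac{d}{dt}\big|_{t=0}f(x+tv)$ when it exists; $\delta_{v,v}f(x)=\frac{d^2}{dt^2}\big|_{t=0}f(x+tv)$ denotes the second Gâteaux differential in direction $v$. Assumption A1: the norm $x\mapsto\|x\|$ is twice Gâteaux differentiable at every nonzero $x$ in all directions, and there are constants $A_1\ge1$, $A_2>0$ with $|\delta_v(\|x\|)|\le A_1\|v\|$ and $|\delta_{v,v}(\|x\|)|\le A_2\|v\|^2/\|x\|$ for all $x,v\in\mathcal B$, $x\ne0$. Assumption A2: there are constants $c,\sigma^2>0$ with $\|X_i\|\le c$ a.s. and $\mathbb E\|X_i\|^2\le\sigma^2$ for all $i$ ($\sigma=\sqrt{\sigma^2}$). Assumption A3: for each $s\in\mathcal B^\star$ the function $h_{1,s}(x)=\langle s,x\rangle$ (restricted to $\mathcal X$) belongs to $\mathcal C$, the function $h_2(x)=\|x\|^2$ belongs to $\mathcal C$, and $\sup_{s\in B^\star(1)}C(h_{1,s})\le C_1$, $C(h_2)\le C_2$ for constants $C_1>0$, $C_2\ge0$. $a\vee b=\max(a,b)$.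 *)

theory Defs
  imports "HOL-Probability.Probability"
begin

definition restr_ball :: "real \<Rightarrow> ('a::real_normed_vector \<Rightarrow> real) \<Rightarrow> 'a \<Rightarrow> real" where
  "restr_ball c f = (\<lambda>x. if x \<in> cball 0 c then f x else 0)"

definition gat1 :: "('a::real_normed_vector \<Rightarrow> real) \<Rightarrow> 'a \<Rightarrow> 'a \<Rightarrow> real" where
  "gat1 f x v = deriv (\<lambda>t. f (x + t *\<^sub>R v)) 0"

definition gat2 :: "('a::real_normed_vector \<Rightarrow> real) \<Rightarrow> 'a \<Rightarrow> 'a \<Rightarrow> real" where
  "gat2 f x v = deriv (\<lambda>s. deriv (\<lambda>t. f (x + t *\<^sub>R v)) s) 0"

definition assumption_A1 :: "'a::real_normed_vector itself \<Rightarrow> real \<Rightarrow> real \<Rightarrow> bool" where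
  "assumption_A1 _ A1 A2 \<longleftrightarrow> A1 \<ge> 1 \<and> A2 > 0 \<and>
     (\<forall>(x::'a) v. x \<noteq> 0 \<longrightarrow>
        (\<lambda>t. norm (x + t *\<^sub>R v)) differentiable (at 0) \<and>
        (\<lambda>s. deriv (\<lambda>t. norm (x + t *\<^sub>R v)) s) differentiable (at 0) \<and>
        \<bar>gat1 norm x v\<bar> \<le> A1 * norm v \<and>
        \<bar>gat2 norm x v\<bar> \<le> A2 * (norm v)\<^sup>2 / norm x)"

text \<open>The class \<open>\<C>\<close>: a closed linear subspace of the bounded real functions on X = B(c)
  (functions represented as vanishing outside X), with a seminorm Csn on it.
  Elements are assumed Borel measurable so that the conditional expectations make sense.\<close>
definition mixing_class :: "real \<Rightarrow> ('a::real_normed_vector \<Rightarrow> real) set \<Rightarrow> (('a \<Rightarrow> real) \<Rightarrow> real) \<Rightarrow> bool" where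
  "mixing_class c Cset Csn \<longleftrightarrow>
     (\<forall>f\<in>Cset. (\<forall>x. x \<notin> cball 0 c \<longrightarrow> f x = 0) \<and> (\<exists>K. \<forall>x. \<bar>f x\<bar> \<le> K) \<and> f \<in> borel_measurable borel) \<and>
     (\<lambda>x. 0) \<in> Cset \<and>
     (\<forall>f\<in>Cset. \<forall>g\<in>Cset. (\<lambda>x. f x + g x) \<in> Cset) \<and>
     (\<forall>f\<in>Cset. \<forall>a::real. (\<lambda>x. a * f x) \<in> Cset) \<and>
     (\<forall>fs f. (\<forall>m. fs m \<in> Cset) \<and> (\<forall>x. x \<notin> cball 0 c \<longrightarrow> f x = 0) \<and>
        (\<exists>K. \<forall>x. \<bar>f x\<bar> \<le> K) \<and>
        ((\<lambda>m. SUP x\<in>cball 0 c. \<bar>fs m x - f x\<bar>) \<longlonglongrightarrow> 0) \<longrightarrow> f \<in> Cset) \<and>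
     (\<forall>f\<in>Cset. Csn f \<ge> 0) \<and>
     (\<forall>f\<in>Cset. \<forall>a::real. Csn (\<lambda>x. a * f x) = \<bar>a\<bar> * Csn f) \<and>
     (\<forall>f\<in>Cset. \<forall>g\<in>Cset. Csn (\<lambda>x. f x + g x) \<le> Csn f + Csn g)"

definition nat_filtration :: "'w measure \<Rightarrow> (nat \<Rightarrow> 'w \<Rightarrow> 'a::topological_space) \<Rightarrow> nat \<Rightarrow> 'w measure" where
  "nat_filtration M X i = sigma (space M) {X j -` A \<inter> space M | j A. j \<in> {1..i} \<and> A \<in> sets borel}"

definition C_mixing_coeff :: "'w measure \<Rightarrow> (nat \<Rightarrow> 'w \<Rightarrow> 'a::topological_space) \<Rightarrow> ('a \<Rightarrow> real) set
     \<Rightarrow> (('a \<Rightarrow> real) \<Rightarrow> real) \<Rightarrow> nat \<Rightarrow> ereal" where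
  "C_mixing_coeff M X Cset Csn k =
     (SUP (\<phi>, i) \<in> {(\<phi>, i). \<phi> \<in> Cset \<and> Csn \<phi> \<le> 1 \<and> i \<ge> 1}.
        esssup M (\<lambda>\<omega>. ereal \<bar>real_cond_exp M (nat_filtration M X i) (\<lambda>\<omega>. \<phi> (X (i + k) \<omega>)) \<omega>
                         - integral\<^sup>L M (\<lambda>\<omega>. \<phi> (X (i + k) \<omega>))\<bar>))"

definition eff_sample_size :: "nat \<Rightarrow> real \<Rightarrow> real \<Rightarrow> real \<Rightarrow> (nat \<Rightarrow> ereal) \<Rightarrow> nat" where
  "eff_sample_size n C1 c \<sigma> Phi =
     Max ({l \<in> {1..n}. ereal C1 * Phi (n div l) \<le> ereal (max (c / real l) (\<sigma> / sqrt (real l)))} \<union> {1})"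

end

(*
  Write psi(x) = cosh (lam * |x|).  Along a segment the second derivative of psi is at most
  (A1^2 + A2) lam^2 |z|^2 psi, so adding one variable Z to a partial sum S of the past costs a factor
  1 + lam a + (A1^2 + A2) lam^2 b in E psi(S), where mixing bounds the conditional drift of Z by a = C1 p
  and its conditional second moment by b = sigma^2 + C2 p, with p the mixing coefficient at the gap.
  The indices 1..n split into k = n div l arithmetic progressions of step k, each of length at least l.
  Jensen's inequality for exp reduces the mean to the progressions, and a Chernoff bound with
  1 / lam = c + sqrt (l V / nu), V = (A1^2 + A2) b, gives the tail.
*)
theory Submission
  imports Defs
begin

text \<open>The norm has no derivative at 0, and its second derivative may grow like 1/|x| nearby.
  Using cosh cures both: the first derivative carries the factor sinh (lam |x|), which vanishes at 0
  and is at most lam |x| cosh (lam |x|). The drift can be bounded only if the first-order term is a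
  continuous linear functional of Z of norm at most 1, since mixing is assumed uniformly for those
  alone. Convexity of the norm supplies linearity. The functional depends on the random base point
  S, with no measurability in S; hence the detour through simple S. Conditional bounds are stated as
  integrals over events E of the past, which fits the fibres of a simple function. The progressions
  have unequal lengths m. Weighting them by m/n turns the exponent mu of the mean into mu/m on each,
  so the drift contributes the same amount for every m and the variance contributes mu^2/m, which is
  worst at the smallest length. The coefficient may be infinite a priori. It is bounded when l
  satisfies the defining inequality; when the effective size is 1, the threshold already exceeds
  c.\<close>

section \<open>Directional derivatives of the norm\<close>

lemma norm_line_derivs:
  fixes x v :: "'a::real_normed_vector"
  assumes "assumption_A1 TYPE('a) A1 A2" and nz: "x + t *\<^sub>R v \<noteq> 0"
  shows "((\<lambda>t. norm (x + t *\<^sub>R v)) has_real_derivative gat1 norm (x + t *\<^sub>R v) v) (at t)"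
    and "((\<lambda>s. deriv (\<lambda>t. norm (x + t *\<^sub>R v)) s) has_real_derivative gat2 norm (x + t *\<^sub>R v) v) (at t)"
    and "\<bar>gat1 norm (x + t *\<^sub>R v) v\<bar> \<le> A1 * norm v"
    and "\<bar>gat2 norm (x + t *\<^sub>R v) v\<bar> \<le> A2 * (norm v)\<^sup>2 / norm (x + t *\<^sub>R v)"
proof -
  let ?f = "\<lambda>t. norm (x + t *\<^sub>R v)" and ?y = "x + t *\<^sub>R v"
  have A: "(\<lambda>u. norm (?y + u *\<^sub>R v)) differentiable (at 0)"
    "(\<lambda>s. deriv (\<lambda>u. norm (?y + u *\<^sub>R v)) s) differentiable (at 0)"
    using assms unfolding assumption_A1_def by blast+
  show "\<bar>gat1 norm ?y v\<bar> \<le> A1 * norm v" "\<bar>gat2 norm ?y v\<bar> \<le> A2 * (norm v)\<^sup>2 / norm ?y"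
    using assms unfolding assumption_A1_def by blast+
  have shift: "(\<lambda>u. norm (?y + u *\<^sub>R v)) = (\<lambda>u. ?f (u + t))"
    by (simp add: algebra_simps)
  \<comment> \<open>This holds at every point, even where \<open>?f\<close> is not differentiable:
    \<open>deriv\<close> chooses from a predicate, and the two predicates coincide.\<close>
  have dshift: "deriv (\<lambda>u. ?f (u + t)) = (\<lambda>s. deriv ?f (s + t))"
    unfolding deriv_def by (simp add: DERIV_shift)
  from A(1) have "((\<lambda>u. norm (?y + u *\<^sub>R v)) has_real_derivative gat1 norm ?y v) (at 0)"
    by (simp add: gat1_def DERIV_deriv_iff_real_differentiable)
  then show "(?f has_real_derivative gat1 norm ?y v) (at t)"
    unfolding shift using DERIV_shift[of ?f "gat1 norm ?y v" 0 t] by simp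
  from A(2) have "((\<lambda>s. deriv (\<lambda>u. norm (?y + u *\<^sub>R v)) s) has_real_derivative gat2 norm ?y v) (at 0)"
    by (simp add: gat2_def DERIV_deriv_iff_real_differentiable)
  then show "((\<lambda>s. deriv ?f s) has_real_derivative gat2 norm ?y v) (at t)"
    unfolding shift unfolding dshift using DERIV_shift[of "deriv ?f" "gat2 norm ?y v" 0 t] by simp
qed

text \<open>A directional derivative is homogeneous, for negative factors too because it is
  two-sided. Convexity makes it subadditive, and the triangle inequality bounds it by the norm of
  the direction. This bound 1 is what lets the drift be measured by the unit ball of the
  dual.\<close>

lemma norm_gateaux_functional:
  fixes x :: "'a::real_normed_vector"
  assumes "\<And>v. (\<lambda>t. norm (x + t *\<^sub>R v)) differentiable (at (0::real))"
  obtains d :: "'a \<Rightarrow>\<^sub>L real" where "norm d \<le> 1"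
    and "\<And>v. ((\<lambda>t. norm (x + t *\<^sub>R v)) has_real_derivative blinfun_apply d v) (at 0)"
proof -
  define G where "G v = deriv (\<lambda>t. norm (x + t *\<^sub>R v)) 0" for v
  have D: "((\<lambda>t. norm (x + t *\<^sub>R v)) has_real_derivative G v) (at 0)" for v
    using assms by (simp add: G_def DERIV_deriv_iff_real_differentiable)
  have scale: "G (r *\<^sub>R v) = r * G v" for r v
  proof -
    have "((\<lambda>t. norm (x + (r * t) *\<^sub>R v)) has_real_derivative G v * r) (at 0)"
      by (rule DERIV_chain'[where f="\<lambda>t. r * t" and g="\<lambda>t. norm (x + t *\<^sub>R v)"])
         (auto intro!: derivative_eq_intros D)
    moreover have "((\<lambda>t. norm (x + (r * t) *\<^sub>R v)) has_real_derivative G (r *\<^sub>R v)) (at 0)"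
      using D[of "r *\<^sub>R v"] by (simp add: mult.commute)
    ultimately show ?thesis using DERIV_unique by (metis mult.commute)
  qed
  have lim: "((\<lambda>t. (norm (x + t *\<^sub>R v) - norm x) / t) \<longlongrightarrow> G v) (at_right 0)" for v
  proof -
    have "((\<lambda>t. (norm (x + t *\<^sub>R v) - norm x) / t) \<longlongrightarrow> G v) (at 0)"
      using D[of v] by (simp add: DERIV_def)
    then show ?thesis by (rule tendsto_mono[rotated]) (simp add: at_le)
  qed
  have subadd: "G (u + v) \<le> G u + G v" for u v
  proof -
    \<comment> \<open>The point x + t(u + v) is the midpoint of x + 2tu and x + 2tv, so convexity
      compares the difference quotients for t > 0.\<close>
    have "G (u + v) \<le> (G (2 *\<^sub>R u) + G (2 *\<^sub>R v)) / 2"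
    proof (rule tendsto_le[OF _ tendsto_divide[OF tendsto_add[OF lim lim] tendsto_const] lim])
      show "\<forall>\<^sub>F t in at_right 0. (norm (x + t *\<^sub>R (u + v)) - norm x) / t \<le>
          ((norm (x + t *\<^sub>R 2 *\<^sub>R u) - norm x) / t + (norm (x + t *\<^sub>R 2 *\<^sub>R v) - norm x) / t) / 2"
        using eventually_at_right_less[of 0]
      proof eventually_elim
        case (elim t)
        have "2 *\<^sub>R (x + t *\<^sub>R (u + v)) = (x + t *\<^sub>R 2 *\<^sub>R u) + (x + t *\<^sub>R 2 *\<^sub>R v)"
          by (simp only: scaleR_2 scaleR_add_right add_ac)
        then have "2 * norm (x + t *\<^sub>R (u + v)) \<le> norm (x + t *\<^sub>R 2 *\<^sub>R u) + norm (x + t *\<^sub>R 2 *\<^sub>R v)"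
          by (metis norm_scaleR norm_triangle_ineq abs_numeral)
        moreover have "(a - m) / t \<le> ((p - m) / t + (q - m) / t) / 2" if "2 * a \<le> p + q" for a p q m
          using mult_right_mono[OF that, of t] elim by (simp add: field_simps)
        ultimately show ?case by blast
      qed
    qed auto
    then show ?thesis by (simp add: scale)
  qed
  \<comment> \<open>Subadditivity at -u and -v is the reverse inequality, since \<open>G\<close> is
    odd.\<close>
  have add: "G (u + v) = G u + G v" for u v
    using subadd[of u v] subadd[of "- u" "- v"] scale[of "-1" u] scale[of "-1" v] scale[of "-1" "u + v"]
    by simp
  have upper: "G v \<le> norm v" for v
  proof (rule tendsto_upperbound[OF lim])
    show "\<forall>\<^sub>F t in at_right 0. (norm (x + t *\<^sub>R v) - norm x) / t \<le> norm v"
      using eventually_at_right_less[of 0]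
    proof eventually_elim
      case (elim t)
      have "norm (x + t *\<^sub>R v) \<le> norm x + t * norm v"
        using norm_triangle_ineq[of x "t *\<^sub>R v"] elim by simp
      then show ?case using elim by (simp add: field_simps)
    qed
  qed auto
  have bound: "norm (G v) \<le> norm v * 1" for v
    using upper[of v] upper[of "- v"] scale[of "-1" v] by simp
  have bl: "bounded_linear G"
    by (rule bounded_linear_intro[OF add _ bound]) (simp add: scale)
  show thesis
  proof (rule that[of "Blinfun G"])
    show "norm (Blinfun G) \<le> 1"
      using bound by (intro norm_blinfun_bound) (simp_all add: bounded_linear_Blinfun_apply[OF bl])
    show "((\<lambda>t. norm (x + t *\<^sub>R v)) has_real_derivative blinfun_apply (Blinfun G) v) (at 0)" for v
      using D by (simp add: bounded_linear_Blinfun_apply[OF bl])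
  qed
qed

section \<open>A second-order bound for the hyperbolic cosine of the norm\<close>

lemma sinh_ge_self: "x \<le> sinh x" if "x \<ge> 0" for x :: real
proof -
  have "sinh 0 - 0 \<le> sinh x - x"
    by (rule DERIV_nonneg_imp_nondecreasing[OF that])
       (auto intro!: exI derivative_eq_intros simp: cosh_real_ge_1)
  then show ?thesis by simp
qed

lemma sinh_le_mult_cosh: "sinh x \<le> x * cosh x" if "x \<ge> 0" for x :: real
proof -
  have "0 * cosh 0 - sinh 0 \<le> x * cosh x - sinh x"
    by (rule DERIV_nonneg_imp_nondecreasing[OF that])
       (auto intro!: exI derivative_eq_intros)
  then show ?thesis by simp
qed

lemma cosh_add_le: "cosh (x + y) \<le> cosh x * exp y" if "y \<ge> 0" for x y :: real
proof -
  have "sinh x * sinh y \<le> cosh x * sinh y"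
    using that sinh_less_cosh_real[of x] by (intro mult_right_mono) (auto)
  then show ?thesis
    by (simp add: cosh_add cosh_plus_sinh[symmetric] algebra_simps)
qed

text \<open>Integrates the inequality twice by monotonicity. A remainder in integral form would
  require regularity of \<open>f''\<close>, and A1 gives none for the second Gateaux
  differential.\<close>

lemma second_derivative_comparison:
  fixes f g f' g' f'' g'' :: "real \<Rightarrow> real"
  assumes f: "\<And>t. t \<in> {0..1} \<Longrightarrow> (f has_real_derivative f' t) (at t)"
    and f': "\<And>t. t \<in> {0..1} \<Longrightarrow> (f' has_real_derivative f'' t) (at t)"
    and g: "\<And>t. t \<in> {0..1} \<Longrightarrow> (g has_real_derivative g' t) (at t)"
    and g': "\<And>t. t \<in> {0..1} \<Longrightarrow> (g' has_real_derivative g'' t) (at t)"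
    and le: "\<And>t. t \<in> {0..1} \<Longrightarrow> f'' t \<le> g'' t"
  shows "f 1 - f 0 - f' 0 \<le> g 1 - g 0 - g' 0"
proof -
  have mono: "g' 0 - f' 0 \<le> g' t - f' t" if "t \<in> {0..1}" for t
    by (rule DERIV_nonneg_imp_nondecreasing)
       (use that le in \<open>auto intro!: exI derivative_eq_intros f' g'\<close>)
  have "g 0 - f 0 - 0 * (g' 0 - f' 0) \<le> g 1 - f 1 - 1 * (g' 0 - f' 0)"
    by (rule DERIV_nonneg_imp_nondecreasing)
       (use mono in \<open>auto intro!: exI derivative_eq_intros f g\<close>)
  then show ?thesis by simp
qed

text \<open>On a segment avoiding 0 the second derivative is compared with that of a multiple of exp
  (lam |z| t), whose Taylor remainder is exactly the last factor. A segment through 0 is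
  one-dimensional and is computed by hand. At s = 0 the value of \<open>d\<close> is irrelevant
  because sinh 0 = 0.\<close>

lemma cosh_norm_taylor:
  fixes s z :: "'a::real_normed_vector"
  assumes A: "assumption_A1 TYPE('a) A1 A2" and lam: "lam \<ge> 0"
    and d: "s \<noteq> 0 \<Longrightarrow> ((\<lambda>t. norm (s + t *\<^sub>R z)) has_real_derivative d) (at 0)"
  shows "cosh (lam * norm (s + z)) \<le> cosh (lam * norm s) + lam * sinh (lam * norm s) * d
          + (A1\<^sup>2 + A2) * cosh (lam * norm s) * (exp (lam * norm z) - 1 - lam * norm z)"
proof -
  define B where "B = A1\<^sup>2 + A2"
  have A12: "A1 \<ge> 1" "A2 > 0" using A by (auto simp: assumption_A1_def)
  then have B: "B \<ge> 1" using one_le_power[of A1 2] unfolding B_def by linarith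
  have rest: "0 \<le> exp (lam * norm z) - 1 - lam * norm z"
    using exp_ge_add_one_self[of "lam * norm z"] by linarith
  consider "s = 0" | t where "s \<noteq> 0" "t \<in> {0..1}" "s + t *\<^sub>R z = 0"
    | "\<forall>t\<in>{0..1}. s + t *\<^sub>R z \<noteq> 0" by blast
  then show ?thesis
  proof cases
    case 1
    have "cosh (lam * norm z) \<le> 1 + 1 * (exp (lam * norm z) - 1 - lam * norm z)"
      using sinh_ge_self[of "lam * norm z"] lam by (simp add: cosh_plus_sinh[symmetric])
    also have "\<dots> \<le> 1 + B * (exp (lam * norm z) - 1 - lam * norm z)"
      using rest B by (intro add_left_mono mult_right_mono) auto
    finally show ?thesis using 1 by (simp add: B_def)
  next
    case 2
    \<comment> \<open>The segment reaches 0 at time 1/r, so z = -r s with r at least 1. Before that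
      time the norm is (1 - u r) |s|, which determines \<open>d\<close>.\<close>
    define r where "r = 1 / t"
    have t: "t > 0" using 2 by (cases "t = 0") auto
    have s: "s = - t *\<^sub>R z" using 2(3) by (simp add: add_eq_0_iff2)
    have z: "z = - r *\<^sub>R s" and r: "r \<ge> 1" using t 2 by (simp_all add: s r_def)
    define x y where "x = lam * norm s" and "y = lam * norm z"
    have xy: "x \<ge> 0" "y \<ge> 0" "y = r * x" using lam r by (auto simp: x_def y_def z)
    have "((\<lambda>t. (1 - t * r) * norm s) has_real_derivative - r * norm s) (at 0)"
      by (auto intro!: derivative_eq_intros)
    then have "((\<lambda>t. norm (s + t *\<^sub>R z)) has_real_derivative - r * norm s) (at 0)"
    proof (rule DERIV_cong_ev[THEN iffD1, rotated -1, OF _ refl _ refl])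
      have "\<forall>\<^sub>F u in nhds 0. u \<in> {..<1 / r}"
        using r by (intro eventually_nhds_in_open) auto
      then show "\<forall>\<^sub>F u in nhds 0. (1 - u * r) * norm s = norm (s + u *\<^sub>R z)"
      proof eventually_elim
        case (elim u)
        have "s + u *\<^sub>R z = (1 - u * r) *\<^sub>R s" by (simp add: z algebra_simps)
        then have "norm (s + u *\<^sub>R z) = \<bar>1 - u * r\<bar> * norm s" by (metis norm_scaleR)
        then show ?case using elim r by (simp add: field_simps)
      qed
    qed
    then have d_eq: "d = - r * norm s" using d[OF 2(1)] DERIV_unique by blast
    have "s + z = (1 - r) *\<^sub>R s" by (simp add: z algebra_simps)
    then have "norm (s + z) = \<bar>1 - r\<bar> * norm s" by (metis norm_scaleR)
    moreover have "x - y = (1 - r) * x" by (simp add: xy algebra_simps)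
    ultimately have "lam * norm (s + z) = \<bar>x - y\<bar>" using lam by (simp add: x_def abs_mult)
    then have "cosh (lam * norm (s + z)) = cosh (x - y)" by simp
    \<comment> \<open>The identity isolates the wanted remainder; the term subtracted last is
      nonnegative because cosh x + sinh x = exp x and y \<le> sinh y.\<close>
    also have "\<dots> = cosh x - y * sinh x + cosh x * (exp y - 1 - y) - (cosh x + sinh x) * (sinh y - y)"
      by (simp add: cosh_diff cosh_plus_sinh[of y, symmetric] algebra_simps)
    also have "\<dots> \<le> cosh x - y * sinh x + 1 * cosh x * (exp y - 1 - y)"
      using sinh_ge_self[of y] xy by simp
    also have "\<dots> \<le> cosh x - y * sinh x + B * cosh x * (exp y - 1 - y)"
      using rest B by (intro add_left_mono mult_right_mono) (auto simp: y_def)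
    also have "y * sinh x = - (lam * sinh x * d)" by (simp add: d_eq xy x_def)
    finally show ?thesis by (simp add: B_def x_def y_def)
  next
    case 3
    define N where "N t = norm (s + t *\<^sub>R z)" for t
    define N' where "N' t = deriv N t" for t
    define N'' where "N'' t = gat2 norm (s + t *\<^sub>R z) z" for t
    note L = norm_line_derivs[OF A]
    have N: "(N has_real_derivative N' t) (at t)" and N'_bound: "\<bar>N' t\<bar> \<le> A1 * norm z"
      and N': "(N' has_real_derivative N'' t) (at t)" and N''_bound: "\<bar>N'' t\<bar> \<le> A2 * (norm z)\<^sup>2 / N t"
      and Npos: "N t > 0"
      if "t \<in> {0..1}" for t
    proof -
      have nz: "s + t *\<^sub>R z \<noteq> 0" using 3 that by auto
      then show "N t > 0" by (simp add: N_def)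
      have "N' t = gat1 norm (s + t *\<^sub>R z) z"
        using L(1)[OF nz] unfolding N'_def N_def[abs_def] by (rule DERIV_imp_deriv)
      with L(1)[OF nz] L(3)[OF nz]
      show "(N has_real_derivative N' t) (at t)" "\<bar>N' t\<bar> \<le> A1 * norm z" by (simp_all add: N_def[abs_def])
      show "(N' has_real_derivative N'' t) (at t)"
        using L(2)[OF nz] unfolding N'_def N''_def N_def .
      show "\<bar>N'' t\<bar> \<le> A2 * (norm z)\<^sup>2 / N t" using L(4)[OF nz] by (simp add: N''_def N_def)
    qed
    let ?f = "\<lambda>t. cosh (lam * N t)" and ?f' = "\<lambda>t. lam * sinh (lam * N t) * N' t"
    let ?f'' = "\<lambda>t. lam\<^sup>2 * cosh (lam * N t) * (N' t)\<^sup>2 + lam * sinh (lam * N t) * N'' t"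
    define K where "K = B * cosh (lam * norm s)"
    define y where "y = lam * norm z"
    let ?g = "\<lambda>t. K * exp (y * t)" and ?g' = "\<lambda>t. K * y * exp (y * t)"
    let ?g'' = "\<lambda>t. K * y\<^sup>2 * exp (y * t)"
    have "?f 1 - ?f 0 - ?f' 0 \<le> ?g 1 - ?g 0 - ?g' 0"
    proof (rule second_derivative_comparison[where f''="?f''" and g''="?g''"])
      fix t :: real assume t: "t \<in> {0..1}"
      show "(?f has_real_derivative ?f' t) (at t)"
        by (auto intro!: derivative_eq_intros N[OF t])
      show "(?f' has_real_derivative ?f'' t) (at t)"
        by (auto intro!: derivative_eq_intros N[OF t] N'[OF t] simp: power2_eq_square algebra_simps)
      show "(?g has_real_derivative ?g' t) (at t)" "(?g' has_real_derivative ?g'' t) (at t)"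
        by (auto intro!: derivative_eq_intros simp: power2_eq_square)
      have 1: "(N' t)\<^sup>2 \<le> A1\<^sup>2 * (norm z)\<^sup>2"
        using power_mono[OF N'_bound[OF t], of 2] by (simp add: power_mult_distrib)
      \<comment> \<open>The factor \<open>N t\<close> gained from sinh cancels the singular 1 /
        \<open>N t\<close> in the bound of \<open>N''\<close>.\<close>
      have "sinh (lam * N t) * N'' t \<le> (lam * N t * cosh (lam * N t)) * (A2 * (norm z)\<^sup>2 / N t)"
        using N''_bound[OF t] Npos[OF t] lam A12
        by (intro order.trans[OF mult_left_mono mult_right_mono] sinh_le_mult_cosh) auto
      also have "\<dots> = lam * cosh (lam * N t) * (A2 * (norm z)\<^sup>2)" using Npos[OF t] by simp
      finally have 2: "lam * (sinh (lam * N t) * N'' t) \<le> lam * (lam * cosh (lam * N t) * (A2 * (norm z)\<^sup>2))"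
        using lam by (intro mult_left_mono) auto
      have "?f'' t \<le> lam\<^sup>2 * cosh (lam * N t) * (A1\<^sup>2 * (norm z)\<^sup>2)
          + lam * (lam * cosh (lam * N t) * (A2 * (norm z)\<^sup>2))"
        using 1 2 by (intro add_mono mult_left_mono) (auto simp: mult.assoc)
      also have "\<dots> = B * y\<^sup>2 * cosh (lam * N t)"
        by (simp add: B_def y_def power2_eq_square algebra_simps)
      also have "\<dots> \<le> B * y\<^sup>2 * (cosh (lam * norm s) * exp (y * t))"
      proof (rule mult_left_mono)
        have "N t \<le> norm s + t * norm z" using norm_triangle_ineq[of s "t *\<^sub>R z"] t by (simp add: N_def)
        then have "lam * N t \<le> lam * norm s + y * t"
          using mult_left_mono[of "N t" "norm s + t * norm z" lam] lam by (simp add: y_def algebra_simps)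
        then have "cosh (lam * N t) \<le> cosh (lam * norm s + y * t)"
          using lam Npos[OF t] t by (intro cosh_real_nonneg_le_iff[THEN iffD2]) (auto simp: y_def)
        also have "\<dots> \<le> cosh (lam * norm s) * exp (y * t)"
          using lam t by (intro cosh_add_le) (auto simp: y_def)
        finally show "cosh (lam * N t) \<le> cosh (lam * norm s) * exp (y * t)" .
        show "0 \<le> B * y\<^sup>2" using B by simp
      qed
      finally show "?f'' t \<le> ?g'' t" by (simp add: K_def algebra_simps)
    qed
    moreover have "d = N' 0"
    proof (rule DERIV_unique)
      show "(N has_real_derivative d) (at 0)" using d 3[rule_format, of 0] unfolding N_def[abs_def] by simp
      show "(N has_real_derivative N' 0) (at 0)" by (rule N) simp
    qed
    ultimately show ?thesis
      by (simp add: N_def K_def B_def y_def algebra_simps)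
  qed
qed

text \<open>\<open>d\<close> is chosen before z and depends on s alone, so for fixed s the
  inequality can be integrated over a random z.\<close>

lemma cosh_norm_step_pointwise:
  fixes s :: "'a::real_normed_vector"
  assumes A: "assumption_A1 TYPE('a) A1 A2" and lam: "lam \<ge> 0"
  obtains d :: "'a \<Rightarrow>\<^sub>L real" where "norm d \<le> 1"
    and "\<And>z. lam * norm z \<le> 1 \<Longrightarrow> cosh (lam * norm (s + z)) \<le> cosh (lam * norm s)
          + lam * sinh (lam * norm s) * blinfun_apply d z
          + (A1\<^sup>2 + A2) * cosh (lam * norm s) * (lam\<^sup>2 * (norm z)\<^sup>2)"
proof -
  obtain d :: "'a \<Rightarrow>\<^sub>L real" where d1: "norm d \<le> 1"
    and d: "\<And>v. s \<noteq> 0 \<Longrightarrow> ((\<lambda>t. norm (s + t *\<^sub>R v)) has_real_derivative blinfun_apply d v) (at 0)"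
  proof (cases "s = 0")
    \<comment> \<open>At s = 0 its coefficient sinh 0 vanishes, so any functional of norm at most 1
      will do.\<close>
    case True
    then show ?thesis using that[of 0] by simp
  next
    case False
    then have "(\<lambda>t. norm (s + t *\<^sub>R v)) differentiable (at (0::real))" for v
      using A by (auto simp: assumption_A1_def)
    from norm_gateaux_functional[OF this] show ?thesis using that by metis
  qed
  show thesis
  proof (rule that[OF d1])
    fix z :: 'a assume z: "lam * norm z \<le> 1"
    have B: "0 \<le> A1\<^sup>2 + A2" using A by (simp add: assumption_A1_def)
    \<comment> \<open>For 0 \<le> y \<le> 1 one has exp y \<le> 1 + y + y^2. This is the source of
      the constraint lam c \<le> 1.\<close>
    have "exp (lam * norm z) - 1 - lam * norm z \<le> lam\<^sup>2 * (norm z)\<^sup>2"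
      using exp_bound[of "lam * norm z"] z lam by (simp add: power_mult_distrib)
    then have "(A1\<^sup>2 + A2) * cosh (lam * norm s) * (exp (lam * norm z) - 1 - lam * norm z)
        \<le> (A1\<^sup>2 + A2) * cosh (lam * norm s) * (lam\<^sup>2 * (norm z)\<^sup>2)"
      using B by (intro mult_left_mono) auto
    with cosh_norm_taylor[OF A lam d, of z]
    show "cosh (lam * norm (s + z)) \<le> cosh (lam * norm s) + lam * sinh (lam * norm s) * blinfun_apply d z
          + (A1\<^sup>2 + A2) * cosh (lam * norm s) * (lam\<^sup>2 * (norm z)\<^sup>2)" by linarith
  qed
qed

section \<open>One step in expectation\<close>

lemma borel_measurable_cosh [measurable]: "(cosh :: real \<Rightarrow> real) \<in> borel_measurable borel"
  by (intro borel_measurable_continuous_onI continuous_intros)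

lemma (in prob_space) integrable_cosh_norm:
  fixes S :: "'a \<Rightarrow> 'b::{banach, second_countable_topology}"
  assumes [measurable]: "S \<in> borel_measurable M" and K: "\<And>\<omega>. \<omega> \<in> space M \<Longrightarrow> norm (S \<omega>) \<le> K"
    and lam: "lam \<ge> 0"
  shows "integrable M (\<lambda>\<omega>. cosh (lam * norm (S \<omega>)))"
proof (rule integrable_const_bound)
  show "AE \<omega> in M. norm (cosh (lam * norm (S \<omega>))) \<le> cosh (lam * K)"
  proof (rule AE_I2)
    fix \<omega> assume "\<omega> \<in> space M"
    then have "lam * norm (S \<omega>) \<le> lam * K" using K lam by (intro mult_left_mono) auto
    moreover have "0 \<le> lam * norm (S \<omega>)" using lam by simp
    ultimately show "norm (cosh (lam * norm (S \<omega>))) \<le> cosh (lam * K)"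
      by (simp add: cosh_real_nonneg_le_iff)
  qed
  show "(\<lambda>\<omega>. cosh (lam * norm (S \<omega>))) \<in> borel_measurable M" by measurable
qed

text \<open>Freezes the first argument on each level set of S, so \<open>g\<close> need only be
  integrable for each fixed y, not jointly measurable.\<close>

lemma (in prob_space) simple_function_sum_fibres:
  fixes g :: "'b \<Rightarrow> 'a \<Rightarrow> real"
  assumes S: "simple_function M S" and int: "\<And>y. y \<in> S ` space M \<Longrightarrow> integrable M (g y)"
  shows "(\<integral>\<omega>. g (S \<omega>) \<omega> \<partial>M) = (\<Sum>y\<in>S ` space M. \<integral>\<omega>. indicator (S -` {y} \<inter> space M) \<omega> * g y \<omega> \<partial>M)"
proof -
  have fin: "finite (S ` space M)" and A: "S -` {y} \<inter> space M \<in> sets M" for y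
    using S simple_functionD by blast+
  have "(\<integral>\<omega>. g (S \<omega>) \<omega> \<partial>M) = (\<integral>\<omega>. (\<Sum>y\<in>S ` space M. indicator (S -` {y} \<inter> space M) \<omega> * g y \<omega>) \<partial>M)"
  proof (rule Bochner_Integration.integral_cong[OF refl])
    fix \<omega> assume \<omega>: "\<omega> \<in> space M"
    have "(\<Sum>y\<in>S ` space M. indicator (S -` {y} \<inter> space M) \<omega> * g y \<omega>)
        = (\<Sum>y\<in>S ` space M. if y = S \<omega> then g y \<omega> else 0)"
      using \<omega> by (intro sum.cong) (auto simp: indicator_def)
    then show "g (S \<omega>) \<omega> = (\<Sum>y\<in>S ` space M. indicator (S -` {y} \<inter> space M) \<omega> * g y \<omega>)"
      using fin \<omega> by simp
  qed
  also have "\<dots> = (\<Sum>y\<in>S ` space M. \<integral>\<omega>. indicator (S -` {y} \<inter> space M) \<omega> * g y \<omega> \<partial>M)"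
    using integrable_mult_indicator[OF A int] by (intro Bochner_Integration.integral_sum) simp
  finally show ?thesis .
qed

text \<open>For simple \<open>S\<close> the derivative functional of the norm is constant on each fibre, so no
  measurability of the derivative in its base point is needed.\<close>

lemma (in prob_space) cosh_norm_step_simple:
  fixes S Z :: "'a \<Rightarrow> 'b::{banach, second_countable_topology}"
  assumes A1: "assumption_A1 TYPE('b) A1 A2" and lam: "lam \<ge> 0" "lam * c \<le> 1"
    and sub: "subalgebra M F" and S: "simple_function F S"
    and [measurable]: "Z \<in> borel_measurable M" and Z: "\<And>\<omega>. \<omega> \<in> space M \<Longrightarrow> norm (Z \<omega>) \<le> c"
    and a: "\<And>E (s :: 'b \<Rightarrow>\<^sub>L real). E \<in> sets F \<Longrightarrow> norm s \<le> 1 \<Longrightarrow>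
      (\<integral>\<omega>. indicator E \<omega> * blinfun_apply s (Z \<omega>) \<partial>M) \<le> a * prob E"
    and b: "\<And>E. E \<in> sets F \<Longrightarrow> (\<integral>\<omega>. indicator E \<omega> * (norm (Z \<omega>))\<^sup>2 \<partial>M) \<le> b * prob E"
    and a0: "a \<ge> 0"
  shows "(\<integral>\<omega>. cosh (lam * norm (S \<omega> + Z \<omega>)) \<partial>M)
      \<le> (1 + lam * a + (A1\<^sup>2 + A2) * lam\<^sup>2 * b) * (\<integral>\<omega>. cosh (lam * norm (S \<omega>)) \<partial>M)"
proof -
  define B where "B = A1\<^sup>2 + A2"
  have B: "B \<ge> 0" using A1 by (simp add: B_def assumption_A1_def)
  have [simp]: "space F = space M" using sub by (simp add: subalgebra_def)
  have S_M: "simple_function M S"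
    using S sub by (auto simp: simple_function_def subalgebra_def)
  let ?A = "\<lambda>y. S -` {y} \<inter> space M"
  have AF: "?A y \<in> sets F" for y using simple_functionD(2)[OF S, of "{y}"] by simp
  then have AM[measurable]: "?A y \<in> sets M" for y using sub by (auto simp: subalgebra_def)
  have bnd: "norm (y + Z \<omega>) \<le> norm y + c" if "\<omega> \<in> space M" for y \<omega>
    using norm_triangle_ineq[of y "Z \<omega>"] Z[OF that] by simp
  have i1: "integrable M (\<lambda>\<omega>. cosh (lam * norm (y + Z \<omega>)))" for y
    by (rule integrable_cosh_norm[OF _ bnd lam(1)]) auto
  have fibre: "(\<integral>\<omega>. indicator (?A y) \<omega> * cosh (lam * norm (y + Z \<omega>)) \<partial>M)
      \<le> (1 + lam * a + B * lam\<^sup>2 * b) * (\<integral>\<omega>. indicator (?A y) \<omega> * cosh (lam * norm y) \<partial>M)" for y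
  proof -
    define E where "E = ?A y"
    have E[measurable]: "E \<in> sets M" and EF: "E \<in> sets F" using AM AF by (auto simp: E_def)
    obtain d :: "'b \<Rightarrow>\<^sub>L real" where d: "norm d \<le> 1"
      and le: "\<And>z. lam * norm z \<le> 1 \<Longrightarrow> cosh (lam * norm (y + z)) \<le> cosh (lam * norm y)
          + lam * sinh (lam * norm y) * blinfun_apply d z
          + (A1\<^sup>2 + A2) * cosh (lam * norm y) * (lam\<^sup>2 * (norm z)\<^sup>2)"
      by (rule cosh_norm_step_pointwise[OF A1 lam(1)]) blast
    define p where "p = cosh (lam * norm y)"
    define q where "q = lam * sinh (lam * norm y)"
    have q: "0 \<le> q" "q \<le> lam * p" using lam sinh_less_cosh_real[of "lam * norm y"]
      by (auto simp: q_def p_def intro!: mult_left_mono)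
    have [measurable]: "(\<lambda>\<omega>. blinfun_apply d (Z \<omega>)) \<in> borel_measurable M"
      by (rule borel_measurable_continuous_on[OF _ \<open>Z \<in> borel_measurable M\<close>])
         (intro continuous_intros)
    have j1: "integrable M (\<lambda>\<omega>. indicator E \<omega> * blinfun_apply d (Z \<omega>))"
    proof (rule integrable_const_bound)
      show "AE \<omega> in M. norm (indicator E \<omega> * blinfun_apply d (Z \<omega>)) \<le> c"
      proof (rule AE_I2)
        fix \<omega> assume "\<omega> \<in> space M"
        have "norm (blinfun_apply d (Z \<omega>)) \<le> norm d * norm (Z \<omega>)" by (rule norm_blinfun)
        also have "\<dots> \<le> 1 * c" using d Z[OF \<open>\<omega> \<in> space M\<close>] by (intro mult_mono) auto
        finally show "norm (indicator E \<omega> * blinfun_apply d (Z \<omega>)) \<le> c"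
          by (auto simp: indicator_def intro: order.trans[OF abs_ge_zero])
      qed
    qed measurable
    have j2: "integrable M (\<lambda>\<omega>. indicator E \<omega> * (norm (Z \<omega>))\<^sup>2)"
      by (rule integrable_const_bound[where B="c\<^sup>2"])
         (auto intro!: AE_I2 power_mono Z simp: indicator_def)
    have j3: "integrable M (\<lambda>\<omega>. indicator E \<omega> :: real)"
      by (simp add: emeasure_eq_measure)
    have "(\<integral>\<omega>. indicator E \<omega> * cosh (lam * norm (y + Z \<omega>)) \<partial>M)
        \<le> (\<integral>\<omega>. p * indicator E \<omega> + q * (indicator E \<omega> * blinfun_apply d (Z \<omega>))
              + B * p * lam\<^sup>2 * (indicator E \<omega> * (norm (Z \<omega>))\<^sup>2) \<partial>M)"
    proof (rule integral_mono)
      show "integrable M (\<lambda>\<omega>. indicator E \<omega> * cosh (lam * norm (y + Z \<omega>)))"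
        using integrable_mult_indicator[OF E i1] by simp
      fix \<omega> assume \<omega>: "\<omega> \<in> space M"
      have "lam * norm (Z \<omega>) \<le> lam * c" using lam Z[OF \<omega>] by (intro mult_left_mono) auto
      with le[of "Z \<omega>"] lam show "indicator E \<omega> * cosh (lam * norm (y + Z \<omega>))
        \<le> p * indicator E \<omega> + q * (indicator E \<omega> * blinfun_apply d (Z \<omega>))
              + B * p * lam\<^sup>2 * (indicator E \<omega> * (norm (Z \<omega>))\<^sup>2)"
        by (simp add: indicator_def p_def q_def B_def mult.assoc)
    qed (use j1 j2 j3 in auto)
    also have "\<dots> = p * prob E + q * (\<integral>\<omega>. indicator E \<omega> * blinfun_apply d (Z \<omega>) \<partial>M)
              + B * p * lam\<^sup>2 * (\<integral>\<omega>. indicator E \<omega> * (norm (Z \<omega>))\<^sup>2 \<partial>M)"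
      using j1 j2 j3 by simp
    also have "\<dots> \<le> p * prob E + q * (a * prob E) + B * p * lam\<^sup>2 * (b * prob E)"
      using a[OF EF d] b[OF EF] q B by (intro add_mono mult_left_mono) (auto simp: p_def)
    \<comment> \<open>sinh \<le> cosh makes the drift a multiple of the same cosh as the other
      terms, so that everything factors; the sign of \<open>a\<close> keeps the direction.\<close>
    also have "\<dots> \<le> p * prob E + lam * p * (a * prob E) + B * p * lam\<^sup>2 * (b * prob E)"
      using mult_right_mono[OF q(2), of "a * prob E"] a0 by simp
    also have "\<dots> = (1 + lam * a + B * lam\<^sup>2 * b) * (prob E * p)" by (simp add: algebra_simps)
    also have "prob E * p = (\<integral>\<omega>. indicator E \<omega> * p \<partial>M)" by simp
    finally show ?thesis by (simp only: E_def p_def)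
  qed
  have "(\<integral>\<omega>. cosh (lam * norm (S \<omega> + Z \<omega>)) \<partial>M)
      = (\<Sum>y\<in>S ` space M. \<integral>\<omega>. indicator (?A y) \<omega> * cosh (lam * norm (y + Z \<omega>)) \<partial>M)"
    by (rule simple_function_sum_fibres[OF S_M i1])
  also have "\<dots> \<le> (\<Sum>y\<in>S ` space M. (1 + lam * a + B * lam\<^sup>2 * b) *
      (\<integral>\<omega>. indicator (?A y) \<omega> * cosh (lam * norm y) \<partial>M))"
    by (rule sum_mono) (rule fibre)
  also have "\<dots> = (1 + lam * a + B * lam\<^sup>2 * b) * (\<integral>\<omega>. cosh (lam * norm (S \<omega>)) \<partial>M)"
    by (subst simple_function_sum_fibres[OF S_M, where g="\<lambda>y \<omega>. cosh (lam * norm y)"])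
       (auto simp: sum_distrib_left)
  finally show ?thesis by (simp only: B_def)
qed

text \<open>Dominated convergence along simple approximants of S, applied to both sides: with Y = Z
  on the left and Y = 0 on the right. The approximants satisfy |T| \<le> 2|S|, hence the bound
  2K.\<close>

lemma (in prob_space) cosh_norm_step:
  fixes S Z :: "'a \<Rightarrow> 'b::{banach, second_countable_topology}"
  assumes A1: "assumption_A1 TYPE('b) A1 A2" and lam: "lam \<ge> 0" "lam * c \<le> 1"
    and sub: "subalgebra M F" and S: "S \<in> borel_measurable F"
    and K: "\<And>\<omega>. \<omega> \<in> space M \<Longrightarrow> norm (S \<omega>) \<le> K"
    and [measurable]: "Z \<in> borel_measurable M" and Z: "\<And>\<omega>. \<omega> \<in> space M \<Longrightarrow> norm (Z \<omega>) \<le> c"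
    and a: "\<And>E (s :: 'b \<Rightarrow>\<^sub>L real). E \<in> sets F \<Longrightarrow> norm s \<le> 1 \<Longrightarrow>
      (\<integral>\<omega>. indicator E \<omega> * blinfun_apply s (Z \<omega>) \<partial>M) \<le> a * prob E"
    and b: "\<And>E. E \<in> sets F \<Longrightarrow> (\<integral>\<omega>. indicator E \<omega> * (norm (Z \<omega>))\<^sup>2 \<partial>M) \<le> b * prob E"
    and a0: "a \<ge> 0"
  shows "(\<integral>\<omega>. cosh (lam * norm (S \<omega> + Z \<omega>)) \<partial>M)
      \<le> (1 + lam * a + (A1\<^sup>2 + A2) * lam\<^sup>2 * b) * (\<integral>\<omega>. cosh (lam * norm (S \<omega>)) \<partial>M)"
proof -
  have spF: "space F = space M" using sub by (simp add: subalgebra_def)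
  obtain T where T: "\<And>i. simple_function F (T i)"
    and lim: "\<And>\<omega>. \<omega> \<in> space M \<Longrightarrow> (\<lambda>i. T i \<omega>) \<longlonglongrightarrow> S \<omega>"
    and T2: "\<And>i \<omega>. \<omega> \<in> space M \<Longrightarrow> norm (T i \<omega>) \<le> 2 * norm (S \<omega>)"
    using borel_measurable_implies_sequence_metric[OF S, of 0] spF by simp metis
  have [measurable]: "S \<in> borel_measurable M" "T i \<in> borel_measurable M" for i
    using S measurable_from_subalg[OF sub] borel_measurable_simple_function[OF T] by blast+
  have TK: "norm (T i \<omega>) \<le> 2 * K" if "\<omega> \<in> space M" for i \<omega> using T2[OF that, of i] K[OF that] by simp
  have conv: "(\<lambda>i. \<integral>\<omega>. cosh (lam * norm (T i \<omega> + Y \<omega>)) \<partial>M) \<longlonglongrightarrow> (\<integral>\<omega>. cosh (lam * norm (S \<omega> + Y \<omega>)) \<partial>M)"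
    if [measurable]: "Y \<in> borel_measurable M" and Y: "\<And>\<omega>. \<omega> \<in> space M \<Longrightarrow> norm (Y \<omega>) \<le> D" for Y D
  proof (rule integral_dominated_convergence[where w="\<lambda>_. cosh (lam * (2 * K + D))"])
    show "AE \<omega> in M. (\<lambda>i. cosh (lam * norm (T i \<omega> + Y \<omega>))) \<longlonglongrightarrow> cosh (lam * norm (S \<omega> + Y \<omega>))"
      by (intro AE_I2 tendsto_intros lim)
    show "AE \<omega> in M. norm (cosh (lam * norm (T i \<omega> + Y \<omega>))) \<le> cosh (lam * (2 * K + D))" for i
    proof (rule AE_I2)
      fix \<omega> assume \<omega>: "\<omega> \<in> space M"
      have "norm (T i \<omega> + Y \<omega>) \<le> 2 * K + D"
        using norm_triangle_ineq[of "T i \<omega>" "Y \<omega>"] TK[OF \<omega>, of i] Y[OF \<omega>] by linarith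
      then have "lam * norm (T i \<omega> + Y \<omega>) \<le> lam * (2 * K + D)" using lam by (intro mult_left_mono) auto
      moreover have "0 \<le> lam * norm (T i \<omega> + Y \<omega>)" using lam by simp
      ultimately show "norm (cosh (lam * norm (T i \<omega> + Y \<omega>))) \<le> cosh (lam * (2 * K + D))"
        by (simp add: cosh_real_nonneg_le_iff)
    qed
    show "(\<lambda>\<omega>. cosh (lam * norm (S \<omega> + Y \<omega>))) \<in> borel_measurable M"
      "(\<lambda>\<omega>. cosh (lam * norm (T i \<omega> + Y \<omega>))) \<in> borel_measurable M" for i
      by measurable
  qed simp
  have conv0: "(\<lambda>i. \<integral>\<omega>. cosh (lam * norm (T i \<omega>)) \<partial>M) \<longlonglongrightarrow> (\<integral>\<omega>. cosh (lam * norm (S \<omega>)) \<partial>M)"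
    using conv[of "\<lambda>_. 0" 0] by simp
  show ?thesis
    by (rule LIMSEQ_le[OF conv[OF _ Z] tendsto_mult_left[OF conv0]])
       (auto intro!: cosh_norm_step_simple[OF A1 lam sub T _ Z a b a0])
qed

section \<open>The natural filtration and the mixing coefficient\<close>

lemma space_nat_filtration [simp]: "space (nat_filtration M X i) = space M"
  by (auto simp: nat_filtration_def intro!: space_measure_of)

lemma sets_nat_filtration:
  "sets (nat_filtration M X i) = sigma_sets (space M) {X j -` A \<inter> space M | j A. j \<in> {1..i} \<and> A \<in> sets borel}"
  by (auto simp: nat_filtration_def intro!: sets_measure_of)

lemma measurable_nat_filtration:
  assumes "j \<in> {1..i}"
  shows "X j \<in> borel_measurable (nat_filtration M X i)"
  using assms by (intro measurableI) (auto simp: sets_nat_filtration intro!: sigma_sets.Basic)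

lemma subalgebra_nat_filtration:
  assumes "\<And>i. i \<ge> 1 \<Longrightarrow> X i \<in> borel_measurable M"
  shows "subalgebra M (nat_filtration M X i)"
proof -
  have "sets (nat_filtration M X i) \<subseteq> sets M"
    unfolding sets_nat_filtration using assms by (intro sets.sigma_sets_subset) (auto intro: measurable_sets)
  then show ?thesis by (simp add: subalgebra_def)
qed

text \<open>Index 0 is the empty past, from which each progression starts.\<close>

lemma nat_filtration_0: "E \<in> sets (nat_filtration M X 0) \<Longrightarrow> E = {} \<or> E = space M"
  by (simp add: sets_nat_filtration sigma_sets_empty_eq)

locale C_mixing_process = prob_space M for M :: "'w measure" +
  fixes X :: "nat \<Rightarrow> 'w \<Rightarrow> 'a::{banach, second_countable_topology}"
    and Cset :: "('a \<Rightarrow> real) set" and Csn :: "('a \<Rightarrow> real) \<Rightarrow> real" and c :: real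
  assumes meas: "\<And>i. i \<ge> 1 \<Longrightarrow> X i \<in> borel_measurable M"
    and mixcls: "mixing_class c Cset Csn"
begin

lemma class_measurable: "\<phi> \<in> Cset \<Longrightarrow> \<phi> \<in> borel_measurable borel"
  and class_bounded: "\<phi> \<in> Cset \<Longrightarrow> \<exists>K. \<forall>x. \<bar>\<phi> x\<bar> \<le> K"
  and class_zero: "(\<lambda>x. 0) \<in> Cset"
  and class_scale: "\<phi> \<in> Cset \<Longrightarrow> (\<lambda>x. r * \<phi> x) \<in> Cset"
  and seminorm_nonneg: "\<phi> \<in> Cset \<Longrightarrow> Csn \<phi> \<ge> 0"
  and seminorm_scale: "\<phi> \<in> Cset \<Longrightarrow> Csn (\<lambda>x. r * \<phi> x) = \<bar>r\<bar> * Csn \<phi>"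
  using mixcls unfolding mixing_class_def by blast+

lemma integrable_class:
  assumes "\<phi> \<in> Cset" "j \<ge> 1"
  shows "integrable M (\<lambda>\<omega>. \<phi> (X j \<omega>))"
proof -
  note [measurable] = class_measurable[OF assms(1)] meas[OF assms(2)]
  obtain K where "\<forall>x. \<bar>\<phi> x\<bar> \<le> K" using class_bounded[OF assms(1)] by blast
  then show ?thesis by (intro integrable_const_bound[where B=K]) auto
qed

lemma AE_cond_exp_le_mixing_coeff:
  assumes "\<phi> \<in> Cset" "Csn \<phi> \<le> 1" "i \<ge> 1"
  shows "AE \<omega> in M. ereal \<bar>real_cond_exp M (nat_filtration M X i) (\<lambda>\<omega>. \<phi> (X (i + k) \<omega>)) \<omega>
      - integral\<^sup>L M (\<lambda>\<omega>. \<phi> (X (i + k) \<omega>))\<bar> \<le> C_mixing_coeff M X Cset Csn k"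
proof -
  let ?f = "\<lambda>\<omega>. ereal \<bar>real_cond_exp M (nat_filtration M X i) (\<lambda>\<omega>. \<phi> (X (i + k) \<omega>)) \<omega>
      - integral\<^sup>L M (\<lambda>\<omega>. \<phi> (X (i + k) \<omega>))\<bar>"
  have le: "esssup M ?f \<le> C_mixing_coeff M X Cset Csn k"
    unfolding C_mixing_coeff_def by (rule SUP_upper2[where i="(\<phi>, i)"]) (use assms in auto)
  show ?thesis using esssup_AE[of ?f M] by eventually_elim (rule order.trans[OF _ le])
qed

text \<open>The zero function is an admissible test function. Besides the sign of p, this excludes
  the value minus infinity.\<close>

lemma mixing_coeff_nonneg: "C_mixing_coeff M X Cset Csn k \<ge> 0"
proof -
  have "Csn (\<lambda>x. 0) = 0" using seminorm_scale[OF class_zero, of 0] by simp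
  with AE_cond_exp_le_mixing_coeff[OF class_zero, of 1 k]
  have "AE \<omega> in M. ereal \<bar>real_cond_exp M (nat_filtration M X 1) (\<lambda>\<omega>. 0) \<omega> - (\<integral>\<omega>. 0 \<partial>M)\<bar>
      \<le> C_mixing_coeff M X Cset Csn k" by simp
  then have "AE \<omega> in M. 0 \<le> C_mixing_coeff M X Cset Csn k"
    by eventually_elim (erule order.trans[rotated], simp)
  then show ?thesis by simp
qed

text \<open>Over an event of the past, the variable may be replaced by its conditional expectation,
  which almost surely exceeds the mean by at most p.\<close>

lemma mixing_integral_bound_unit:
  assumes \<phi>: "\<phi> \<in> Cset" "Csn \<phi> \<le> 1" and i: "i \<ge> 1" and E: "E \<in> sets (nat_filtration M X i)"
    and p: "C_mixing_coeff M X Cset Csn k = ereal p"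
  shows "(\<integral>\<omega>. indicator E \<omega> * \<phi> (X (i + k) \<omega>) \<partial>M) \<le> prob E * (\<integral>\<omega>. \<phi> (X (i + k) \<omega>) \<partial>M) + p * prob E"
proof -
  let ?F = "nat_filtration M X i" and ?f = "\<lambda>\<omega>. \<phi> (X (i + k) \<omega>)"
  have sub: "subalgebra M ?F" by (rule subalgebra_nat_filtration[OF meas])
  interpret finite_measure_subalgebra M ?F by unfold_locales (rule sub)
  have EM[measurable]: "E \<in> sets M" using E sub by (auto simp: subalgebra_def)
  have int: "integrable M ?f" using integrable_class[OF \<phi>(1)] i by simp
  note cint = real_cond_exp_int(1)[OF int]
  have "(\<integral>\<omega>. indicator E \<omega> * ?f \<omega> \<partial>M) = (\<integral>\<omega>. indicator E \<omega> * real_cond_exp M ?F ?f \<omega> \<partial>M)"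
    using real_cond_exp_intA[OF int E] by (simp add: set_lebesgue_integral_def)
  also have "\<dots> \<le> (\<integral>\<omega>. indicator E \<omega> * (integral\<^sup>L M ?f + p) \<partial>M)"
  proof (rule integral_mono_AE)
    show "integrable M (\<lambda>\<omega>. indicator E \<omega> * real_cond_exp M ?F ?f \<omega>)"
      using integrable_mult_indicator[OF EM cint] by simp
    show "integrable M (\<lambda>\<omega>. indicator E \<omega> * (integral\<^sup>L M ?f + p))"
      using integrable_mult_indicator[OF EM, of "\<lambda>_. integral\<^sup>L M ?f + p"] by simp
    show "AE \<omega> in M. indicator E \<omega> * real_cond_exp M ?F ?f \<omega> \<le> indicator E \<omega> * (integral\<^sup>L M ?f + p)"
      using AE_cond_exp_le_mixing_coeff[OF \<phi> i, of k]
      by eventually_elim (auto simp: p indicator_def)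
  qed
  also have "\<dots> = prob E * integral\<^sup>L M ?f + p * prob E"
    using EM by (simp flip: distrib_left distrib_right) (simp add: algebra_simps)
  finally show ?thesis .
qed

lemma mixing_integral_bound:
  assumes \<phi>: "\<phi> \<in> Cset" "Csn \<phi> \<le> K" and i: "i \<ge> 1" and E: "E \<in> sets (nat_filtration M X i)"
    and p: "C_mixing_coeff M X Cset Csn k = ereal p"
  shows "(\<integral>\<omega>. indicator E \<omega> * \<phi> (X (i + k) \<omega>) \<partial>M) \<le> prob E * (\<integral>\<omega>. \<phi> (X (i + k) \<omega>) \<partial>M) + K * p * prob E"
    (is "?L \<le> ?R + _")
proof -
  have K: "K \<ge> 0" using seminorm_nonneg[OF \<phi>(1)] \<phi>(2) by linarith
  have p0: "p \<ge> 0" using mixing_coeff_nonneg[of k] p by simp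
  \<comment> \<open>\<open>K\<close> may be 0, so \<phi> is normalised by an arbitrary r >
    \<open>K\<close>, which then decreases to \<open>K\<close>.\<close>
  have r: "?L \<le> ?R + r * p * prob E" if r: "r > K" for r
  proof -
    have r0: "r > 0" using K r by simp
    have "Csn (\<lambda>x. (1 / r) * \<phi> x) \<le> 1" using seminorm_scale[OF \<phi>(1), of "1 / r"] \<phi> r r0 by simp
    from mixing_integral_bound_unit[OF class_scale[OF \<phi>(1)] this i E p]
    have "?L / r \<le> (?R + r * p * prob E) / r" using r0 by (simp add: add_divide_distrib)
    then show ?thesis using r0 by (simp add: divide_le_cancel)
  qed
  show ?thesis
  proof (rule field_le_epsilon)
    fix e :: real assume e: "e > 0"
    \<comment> \<open>The added 1 keeps the denominator positive when p or the probability of E is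
      0.\<close>
    define d where "d = e / (p * prob E + 1)"
    have pos: "p * prob E + 1 > 0" using p0 by (simp add: add_nonneg_pos)
    then have d: "d > 0" "d * (p * prob E) \<le> e"
      using e p0 by (simp_all add: d_def field_simps)
    have "?L \<le> ?R + (K + d) * p * prob E" using d by (intro r) simp
    with d show "?L \<le> ?R + K * p * prob E + e" by (simp add: algebra_simps)
  qed
qed

end

section \<open>Exponential moments along one progression\<close>

locale centered_C_mixing_process = C_mixing_process M X Cset Csn c
  for M :: "'w measure" and X :: "nat \<Rightarrow> 'w \<Rightarrow> 'a::{banach, second_countable_topology}"
    and Cset :: "('a \<Rightarrow> real) set" and Csn :: "('a \<Rightarrow> real) \<Rightarrow> real" and c :: real +
  fixes \<sigma> A1 A2 C1 C2 :: real
  assumes vals: "\<And>i \<omega>. i \<ge> 1 \<Longrightarrow> \<omega> \<in> space M \<Longrightarrow> norm (X i \<omega>) \<le> c"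
    and centered: "\<And>i. i \<ge> 1 \<Longrightarrow> integral\<^sup>L M (X i) = 0"
    and A1: "assumption_A1 TYPE('a) A1 A2"
    and variance_le: "\<And>i. i \<ge> 1 \<Longrightarrow> integral\<^sup>L M (\<lambda>\<omega>. (norm (X i \<omega>))\<^sup>2) \<le> \<sigma>\<^sup>2"
    and linear_class: "\<And>s::'a \<Rightarrow>\<^sub>L real. restr_ball c (blinfun_apply s) \<in> Cset"
    and square_class: "restr_ball c (\<lambda>x. (norm x)\<^sup>2) \<in> Cset"
    and linear_seminorm: "\<And>s::'a \<Rightarrow>\<^sub>L real. norm s \<le> 1 \<Longrightarrow> Csn (restr_ball c (blinfun_apply s)) \<le> C1"
    and square_seminorm: "Csn (restr_ball c (\<lambda>x. (norm x)\<^sup>2)) \<le> C2"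
begin

lemma C1_nonneg: "C1 \<ge> 0" and C2_nonneg: "C2 \<ge> 0"
  using order.trans[OF seminorm_nonneg[OF linear_class] linear_seminorm[of 0]]
    order.trans[OF seminorm_nonneg[OF square_class] square_seminorm] by simp_all

lemma borel_measurable_progression [measurable]:
  "i \<ge> 1 \<Longrightarrow> (\<lambda>\<omega>. \<Sum>q<m. X (i + q * k) \<omega>) \<in> borel_measurable M"
  by (intro borel_measurable_sum meas) simp

lemma norm_progression_le:
  assumes "i \<ge> 1" "\<omega> \<in> space M"
  shows "norm (\<Sum>q<m. X (i + q * k) \<omega>) \<le> real m * c"
  using sum_norm_le[of "{..<m}" "\<lambda>q. X (i + q * k) \<omega>" "\<lambda>_. c"] vals assms by simp

lemma expectation_functional:
  assumes "j \<ge> 1"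
  shows "(\<integral>\<omega>. blinfun_apply s (X j \<omega>) \<partial>M) = 0"
proof -
  have "integrable M (X j)"
    using vals meas assms by (intro integrable_const_bound[where B=c]) auto
  then show ?thesis
    using integral_bounded_linear[OF blinfun.bounded_linear_right[of s], of M "X j"] centered[OF assms] by simp
qed

text \<open>Each new term lies exactly k steps after the last one used, so
  \<open>cosh_norm_step\<close> contributes the same factor every time.\<close>

lemma cosh_progression_bound:
  assumes lam: "lam \<ge> 0" "lam * c \<le> 1" and i: "i \<ge> 1"
    and p: "C_mixing_coeff M X Cset Csn k = ereal p"
  shows "(\<integral>\<omega>. cosh (lam * norm (\<Sum>q<m. X (i + q * k) \<omega>)) \<partial>M)
      \<le> (1 + lam * (C1 * p) + (A1\<^sup>2 + A2) * lam\<^sup>2 * (\<sigma>\<^sup>2 + C2 * p)) ^ m"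
proof (induction m)
  case 0
  then show ?case by (simp add: prob_space)
next
  case (Suc m)
  define j where "j = i + m * k"
  have j: "j \<ge> 1" using i by (simp add: j_def)
  \<comment> \<open>At m = 0 truncated subtraction would give index i and put the variable to be
    added, \<open>X i\<close>, into its own past; index 0 gives the trivial sigma-algebra
    instead.\<close>
  define F where "F = nat_filtration M X (if m = 0 then 0 else i + (m - 1) * k)"
  have sub: "subalgebra M F" unfolding F_def by (rule subalgebra_nat_filtration[OF meas])
  have p0: "p \<ge> 0" using mixing_coeff_nonneg[of k] p by simp
  \<comment> \<open>Mixing across the gap k for m > 0. At m = 0 the event is empty or the whole
    space, and the error term is simply nonnegative.\<close>
  have decouple: "(\<integral>\<omega>. indicator E \<omega> * \<phi> (X j \<omega>) \<partial>M) \<le> prob E * (\<integral>\<omega>. \<phi> (X j \<omega>) \<partial>M) + K * p * prob E"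
    if E: "E \<in> sets F" and \<phi>: "\<phi> \<in> Cset" "Csn \<phi> \<le> K" for E \<phi> K
  proof (cases "m = 0")
    case True
    have K: "K \<ge> 0" using seminorm_nonneg[OF \<phi>(1)] \<phi>(2) by linarith
    have "E = {} \<or> E = space M" using E True by (intro nat_filtration_0) (simp add: F_def)
    then show ?thesis
    proof
      assume "E = space M"
      moreover have "(\<integral>\<omega>. indicator (space M) \<omega> * \<phi> (X j \<omega>) \<partial>M) = (\<integral>\<omega>. \<phi> (X j \<omega>) \<partial>M)"
        by (rule Bochner_Integration.integral_cong) auto
      ultimately show ?thesis using K p0 by (simp add: prob_space)
    qed simp
  next
    case False
    then have "i + (m - 1) * k + k = j" by (cases m) (simp_all add: j_def)
    with mixing_integral_bound[OF \<phi> _ _ p, of "i + (m - 1) * k" E] E False i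
    show ?thesis by (simp add: F_def)
  qed
  have on_ball: "restr_ball c h (X j \<omega>) = h (X j \<omega>)" if "\<omega> \<in> space M" for h :: "'a \<Rightarrow> real" and \<omega>
    using vals[OF j that] by (simp add: restr_ball_def)
  have restr: "(\<integral>\<omega>. indicator E \<omega> * restr_ball c h (X j \<omega>) \<partial>M) = (\<integral>\<omega>. indicator E \<omega> * h (X j \<omega>) \<partial>M)"
    "(\<integral>\<omega>. restr_ball c h (X j \<omega>) \<partial>M) = (\<integral>\<omega>. h (X j \<omega>) \<partial>M)" for h :: "'a \<Rightarrow> real" and E :: "'w set"
    by (intro Bochner_Integration.integral_cong refl, simp add: on_ball)+
  let ?S = "\<lambda>\<omega>. \<Sum>q<m. X (i + q * k) \<omega>"
  let ?\<rho> = "1 + lam * (C1 * p) + (A1\<^sup>2 + A2) * lam\<^sup>2 * (\<sigma>\<^sup>2 + C2 * p)"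
  have "(\<integral>\<omega>. cosh (lam * norm (?S \<omega> + X j \<omega>)) \<partial>M) \<le> ?\<rho> * (\<integral>\<omega>. cosh (lam * norm (?S \<omega>)) \<partial>M)"
  proof (rule cosh_norm_step[OF A1 lam sub])
    show "?S \<in> borel_measurable F"
    proof (intro borel_measurable_sum)
      fix q assume q: "q \<in> {..<m}"
      then have "q * k \<le> (m - 1) * k" by (intro mult_right_mono) auto
      with q i show "X (i + q * k) \<in> borel_measurable F"
        unfolding F_def by (intro measurable_nat_filtration) auto
    qed
    show "norm (?S \<omega>) \<le> real m * c" if "\<omega> \<in> space M" for \<omega>
      using norm_progression_le[OF i that] .
    show "X j \<in> borel_measurable M" by (rule meas[OF j])
    show "norm (X j \<omega>) \<le> c" if "\<omega> \<in> space M" for \<omega> by (rule vals[OF j that])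
    show "(\<integral>\<omega>. indicator E \<omega> * blinfun_apply s (X j \<omega>) \<partial>M) \<le> C1 * p * prob E"
      if "E \<in> sets F" "norm s \<le> 1" for E and s :: "'a \<Rightarrow>\<^sub>L real"
      using decouple[OF that(1) linear_class linear_seminorm[OF that(2)]]
      by (simp add: restr expectation_functional[OF j])
    show "(\<integral>\<omega>. indicator E \<omega> * (norm (X j \<omega>))\<^sup>2 \<partial>M) \<le> (\<sigma>\<^sup>2 + C2 * p) * prob E" if "E \<in> sets F" for E
      using decouple[OF that square_class square_seminorm] mult_left_mono[OF variance_le[OF j], of "prob E"]
      unfolding restr by (simp add: algebra_simps)
    show "0 \<le> C1 * p" using C1_nonneg p0 by simp
  qed
  also have "\<dots> \<le> ?\<rho> * ?\<rho> ^ m"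
    using Suc.IH A1 lam C1_nonneg C2_nonneg p0
    by (intro mult_left_mono) (auto simp: assumption_A1_def intro!: add_nonneg_nonneg mult_nonneg_nonneg)
  finally show ?case by (simp add: j_def)
qed

end

section \<open>Residue classes and the choice of the exponent\<close>

text \<open>Used twice: with f = 1 it shows that the weights of the progressions sum to 1, with the
  process itself it splits the sum.\<close>

lemma sum_over_residues:
  fixes f :: "nat \<Rightarrow> 'b::comm_monoid_add"
  assumes "k \<ge> 1" "k \<le> n"
  shows "(\<Sum>i=1..k. \<Sum>q<(n - i) div k + 1. f (i + q * k)) = (\<Sum>j=1..n. f j)"
proof -
  have "(\<Sum>i=1..k. \<Sum>q<(n - i) div k + 1. f (i + q * k))
      = (\<Sum>(i, q)\<in>(SIGMA i:{1..k}. {..<(n - i) div k + 1}). f (i + q * k))"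
    by (rule sum.Sigma) auto
  also have "\<dots> = (\<Sum>j=1..n. f j)"
  \<comment> \<open>Starting points run over 1..k and not 0..k-1, hence the shift by one around div
    and mod.\<close>
  proof (rule sum.reindex_bij_witness[where j="\<lambda>(i, q). i + q * k" and i="\<lambda>j. ((j - 1) mod k + 1, (j - 1) div k)"])
    fix x assume "x \<in> (SIGMA i:{1..k}. {..<(n - i) div k + 1})"
    then obtain i q where x: "x = (i, q)" "1 \<le> i" "i \<le> k" "q \<le> (n - i) div k" by auto
    have "q * k \<le> (n - i) div k * k" using x by simp
    also have "\<dots> \<le> n - i" by (rule div_times_less_eq_dividend)
    finally have "i + q * k \<le> n" using x assms by linarith
    then show "(case x of (i, q) \<Rightarrow> i + q * k) \<in> {1..n}" using x by simp
    obtain i' where "i = Suc i'" "i' < k" using x by (cases i) auto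
    then show "((\<lambda>j. ((j - 1) mod k + 1, (j - 1) div k)) (case x of (i, q) \<Rightarrow> i + q * k)) = x"
      using x by simp
  next
    fix j assume j: "j \<in> {1..n}"
    then have j1: "1 \<le> j" "j \<le> n" by auto
    have e: "(j - 1) mod k + (j - 1) div k * k = j - 1" by simp
    then show "(case ((j - 1) mod k + 1, (j - 1) div k) of (i, q) \<Rightarrow> i + q * k) = j"
      using j by simp
    have "(j - 1) div k * k \<le> n - ((j - 1) mod k + 1)" using e j1 by linarith
    then have "(j - 1) div k \<le> (n - ((j - 1) mod k + 1)) div k"
      using assms by (simp add: less_eq_div_iff_mult_less_eq)
    moreover have "(j - 1) mod k < k" using assms by simp
    ultimately show "((j - 1) mod k + 1, (j - 1) div k) \<in> (SIGMA i:{1..k}. {..<(n - i) div k + 1})"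
      by simp
  qed auto
  finally show ?thesis .
qed

text \<open>After the starting point i, l - 1 further steps fit, since (l - 1) k \<le> n - k \<le> n
  - i.\<close>

lemma le_block_length:
  fixes i k l n :: nat
  assumes "i \<le> k" "k \<ge> 1" "l * k \<le> n"
  shows "l \<le> (n - i) div k + 1"
proof (cases l)
  case (Suc l')
  then have "l' * k \<le> n - i" using assms by simp
  then show ?thesis using Suc assms by (simp add: less_eq_div_iff_mult_less_eq)
qed simp

text \<open>Here u stands for C1 p and D for C2 / (C1 c), so that D c u = C2 p and the mixing
  coefficient enters through u alone.\<close>

lemma bernstein_parameter:
  fixes c \<sigma> A1 B D u \<nu> l :: real
  assumes pos: "c > 0" "\<sigma> > 0" "\<nu> \<ge> 1" "l \<ge> 1" "A1 \<ge> 1" "B > 0" "D \<ge> 0" "u \<ge> 0"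
    and u: "u \<le> max (c / l) (\<sigma> / sqrt l)"
  obtains lam where "lam \<ge> 0" "lam * c \<le> 1"
    "lam * u + B * lam\<^sup>2 * (\<sigma>\<^sup>2 + D * c * u)
      - lam * (\<sigma> * (4 * A1 + 6 * sqrt B * sqrt \<nu>) / sqrt l
        + c * (4 * A1 + (2 + 2 * sqrt B * (1 + 2 * D)) * \<nu>) / l) \<le> - \<nu> / l"
proof -
  define t where "t = \<sigma> * (4 * A1 + 6 * sqrt B * sqrt \<nu>) / sqrt l
        + c * (4 * A1 + (2 + 2 * sqrt B * (1 + 2 * D)) * \<nu>) / l"
  define V where "V = B * (\<sigma>\<^sup>2 + D * c * u)"
  define g where "g = sqrt (V * l / \<nu>)"
  \<comment> \<open>The summand c gives lam c \<le> 1; the summand g gives lam g \<le> 1, hence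
    lam^2 V \<le> \<nu> / l. It then suffices that t - u \<ge> 2 (\<nu> / l) (c + g): one \<nu> / l
    pays for the variance, the other remains.\<close>
  define lam where "lam = 1 / (c + g)"
  define e where "e = c / sqrt l"
  have V: "V \<ge> 0" using pos by (simp add: V_def)
  have g: "g \<ge> 0" "g\<^sup>2 = V * l / \<nu>" using V pos by (simp_all add: g_def)
  have e: "e > 0" "c / l = e / sqrt l" "c * (c / l) = e\<^sup>2" "c * (\<sigma> / sqrt l) = e * \<sigma>"
    using pos by (simp_all add: e_def power2_eq_square divide_divide_eq_left)
  have lam: "lam > 0" "lam * c \<le> 1" "lam * g \<le> 1" "lam * (c + g) = 1"
    using pos g by (simp_all add: lam_def field_simps add_pos_nonneg)
  have u2: "u \<le> c / l + \<sigma> / sqrt l" using u pos by (simp add: max_def split: if_splits) (smt (verit) divide_pos_pos real_sqrt_gt_zero)+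
  have "c * u \<le> c * (c / l + \<sigma> / sqrt l)" using u2 pos by (intro mult_left_mono) auto
  also have "\<dots> = e\<^sup>2 + e * \<sigma>" using e by (simp add: distrib_left)
  finally have "D * (c * u) \<le> D * (e\<^sup>2 + e * \<sigma>)" using pos by (intro mult_left_mono) auto
  \<comment> \<open>A perfect square is needed because \<open>g\<close> contains the root of V. Its
    coefficient 1 + 2D becomes the factor in M1.\<close>
  moreover have "\<sigma>\<^sup>2 + D * (e\<^sup>2 + e * \<sigma>) \<le> (\<sigma> + (1 + 2 * D) * e)\<^sup>2"
  proof -
    have "0 \<le> (1 + 3 * D + 4 * D\<^sup>2) * e\<^sup>2 + (2 + 3 * D) * (e * \<sigma>)" using pos e by simp
    then show ?thesis by (simp add: power2_eq_square algebra_simps)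
  qed
  ultimately have "V \<le> B * (\<sigma> + (1 + 2 * D) * e)\<^sup>2"
    unfolding V_def using pos by (intro mult_left_mono) (auto simp: mult.assoc)
  then have "sqrt V \<le> sqrt B * (\<sigma> + (1 + 2 * D) * e)"
    using pos e real_sqrt_le_mono by (fastforce simp: real_sqrt_mult)
  then have "sqrt V * (sqrt \<nu> / sqrt l) \<le> sqrt B * (\<sigma> + (1 + 2 * D) * e) * (sqrt \<nu> / sqrt l)"
    using pos by (intro mult_right_mono) auto
  moreover have "\<nu> / l * g = sqrt V * (sqrt \<nu> / sqrt l)"
  proof -
    have "\<nu> / l = (sqrt \<nu> / sqrt l) * (sqrt \<nu> / sqrt l)" "g = sqrt V * (sqrt l / sqrt \<nu>)"
      using pos by (simp_all add: g_def real_sqrt_mult real_sqrt_divide)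
    moreover have "(a / b) * (a / b) * (v * (b / a)) = v * (a / b)" if "a > 0" "b > 0" for a b v :: real
      using that by simp
    ultimately show ?thesis using pos by (simp only: real_sqrt_gt_zero)
  qed
  ultimately have g2: "\<nu> / l * g \<le> sqrt B * sqrt \<nu> * \<sigma> / sqrt l + sqrt B * (1 + 2 * D) * sqrt \<nu> * (c / l)"
    unfolding e(2) by (simp add: algebra_simps add_divide_distrib)
  \<comment> \<open>Only the part proportional to c / l is weakened to \<nu>; the part with \<sigma>
    keeps its square root.\<close>
  have "sqrt \<nu> \<le> \<nu>" using pos real_sqrt_le_mono[of \<nu> "\<nu>\<^sup>2"] by (simp add: power2_eq_square)
  then have "sqrt B * (1 + 2 * D) * sqrt \<nu> * (c / l) \<le> sqrt B * (1 + 2 * D) * \<nu> * (c / l)"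
    using pos by (intro mult_right_mono mult_left_mono) auto
  with g2 have g3: "\<nu> / l * g \<le> sqrt B * sqrt \<nu> * \<sigma> / sqrt l + sqrt B * (1 + 2 * D) * \<nu> * (c / l)" by linarith
  have A: "\<sigma> / sqrt l \<le> A1 * (\<sigma> / sqrt l)" "c / l \<le> A1 * (c / l)"
    using pos mult_right_mono[of 1 A1 "\<sigma> / sqrt l"] mult_right_mono[of 1 A1 "c / l"] by simp_all
  have nn: "0 \<le> A1 * (\<sigma> / sqrt l)" "0 \<le> A1 * (c / l)" "0 \<le> sqrt B * sqrt \<nu> * \<sigma> / sqrt l" using pos by auto
  have t_eq: "t = 4 * (A1 * (\<sigma> / sqrt l)) + 6 * (sqrt B * sqrt \<nu> * \<sigma> / sqrt l) + 4 * (A1 * (c / l))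
      + 2 * (\<nu> / l * c) + 2 * (sqrt B * (1 + 2 * D) * \<nu> * (c / l))"
    by (simp add: t_def algebra_simps add_divide_distrib)
  \<comment> \<open>x and z are the A1 terms and absorb u; q and h are the parts of (\<nu> / l) (c +
    g) from c and from g. The two summands 2q and 2w are precisely the contribution of M1.\<close>
  have lin: "b \<le> t' - u'" if "t' = 4 * x + 6 * y + 4 * z + 2 * q + 2 * w" "b = 2 * q + 2 * h" "h \<le> y + w"
    "s \<le> x" "r \<le> z" "0 \<le> x" "0 \<le> z" "0 \<le> y" "u' \<le> r + s" for b h q r s t' u' w x y z :: real
    using that by linarith
  have "2 * (\<nu> / l * (c + g)) = 2 * (\<nu> / l * c) + 2 * (\<nu> / l * g)" by (simp only: distrib_left)
  then have "2 * (\<nu> / l * (c + g)) \<le> t - u" by (rule lin[OF t_eq _ g3 A nn u2])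
  then have "lam * (2 * (\<nu> / l * (c + g))) \<le> lam * (t - u)" using lam by (intro mult_left_mono) auto
  moreover have "lam * (2 * (\<nu> / l * (c + g))) = 2 * (\<nu> / l) * (lam * (c + g))" by (simp only: mult_ac)
  ultimately have t: "2 * (\<nu> / l) \<le> lam * (t - u)" by (simp only: lam(4) mult_1_right)
  have "(lam * g)\<^sup>2 \<le> 1\<^sup>2" using lam g by (intro power_mono) auto
  then have "lam\<^sup>2 * V \<le> \<nu> / l" using g pos by (simp add: power_mult_distrib field_simps)
  with t have "lam * u + lam\<^sup>2 * V - lam * t \<le> - \<nu> / l"
    unfolding right_diff_distrib minus_divide_left[symmetric] by linarith
  then show thesis using that[of lam] lam by (simp add: t_def V_def algebra_simps)
qed

section \<open>Exponential moment and tail of the mean\<close>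

context centered_C_mixing_process
begin

lemma exp_norm_mean_bound:
  assumes \<mu>: "\<mu> \<ge> 0" "\<mu> / real l * c \<le> 1" and l: "l \<in> {1..n}"
    and p: "C_mixing_coeff M X Cset Csn (n div l) = ereal p"
  shows "(\<integral>\<omega>. exp (\<mu> * norm ((1 / real n) *\<^sub>R (\<Sum>i=1..n. X i \<omega>))) \<partial>M)
      \<le> 2 * exp (\<mu> * (C1 * p) + (A1\<^sup>2 + A2) * \<mu>\<^sup>2 / real l * (\<sigma>\<^sup>2 + C2 * p))"
proof -
  define k where "k = n div l"
  define B where "B = A1\<^sup>2 + A2"
  define V where "V = \<sigma>\<^sup>2 + C2 * p"
  define R where "R = exp (\<mu> * (C1 * p) + B * \<mu>\<^sup>2 / real l * V)"
  have p0: "p \<ge> 0" using mixing_coeff_nonneg[of "n div l"] p by simp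
  have B: "B \<ge> 0" using A1 by (simp add: B_def assumption_A1_def)
  have V: "V \<ge> 0" using C2_nonneg p0 by (simp add: V_def)
  have k: "k \<ge> 1" "k \<le> n" "l * k \<le> n" using l by (auto simp: k_def div_greater_zero_iff Suc_le_eq)
  define m where "m i = (n - i) div k + 1" for i
  have lm: "l \<le> m i" if "i \<in> {1..k}" for i using le_block_length[of i k l n] k that by (simp add: m_def)
  have m0: "m i > 0" for i by (simp add: m_def)
  have n0: "n > 0" using l by simp
  define S where "S i \<omega> = (\<Sum>q<m i. X (i + q * k) \<omega>)" for i \<omega>
  have sum_m: "(\<Sum>i=1..k. real (m i)) = real n"
    using sum_over_residues[OF k(1,2), of "\<lambda>_. 1::real"] by (simp add: m_def)
  have sum_S: "(\<Sum>i=1..k. S i \<omega>) = (\<Sum>i=1..n. X i \<omega>)" for \<omega>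
    using sum_over_residues[OF k(1,2), of "\<lambda>j. X j \<omega>"] by (simp add: m_def S_def)
  have int: "integrable M (\<lambda>\<omega>. cosh (\<mu> / real (m i) * norm (S i \<omega>)))" if "i \<in> {1..k}" for i
    using that \<mu> unfolding S_def
    by (intro integrable_cosh_norm[where K="real (m i) * c"] norm_progression_le borel_measurable_progression) auto
  have block: "(\<integral>\<omega>. cosh (\<mu> / real (m i) * norm (S i \<omega>)) \<partial>M) \<le> R" if i: "i \<in> {1..k}" for i
  proof -
    define lam where "lam = \<mu> / real (m i)"
    have lam0: "lam \<ge> 0" using \<mu> by (simp add: lam_def)
    have "c \<ge> 0" using vals[of 1] not_empty norm_ge_zero order.trans by blast
    have "lam \<le> \<mu> / real l" using lm[OF i] l \<mu> by (auto simp: lam_def intro!: divide_left_mono)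
    then have "lam * c \<le> \<mu> / real l * c" using \<open>c \<ge> 0\<close> by (intro mult_right_mono)
    then have lamc: "lam * c \<le> 1" using \<mu> by linarith
    have "(\<integral>\<omega>. cosh (lam * norm (S i \<omega>)) \<partial>M) \<le> (1 + lam * (C1 * p) + B * lam\<^sup>2 * V) ^ m i"
      unfolding S_def B_def V_def using i p by (intro cosh_progression_bound lam0 lamc) (auto simp: k_def)
    also have "\<dots> \<le> exp (lam * (C1 * p) + B * lam\<^sup>2 * V) ^ m i"
      using lam0 B V C1_nonneg p0 exp_ge_add_one_self[of "lam * (C1 * p) + B * lam\<^sup>2 * V"]
      by (intro power_mono) (auto simp: add.assoc intro!: add_nonneg_nonneg)
    also have "\<dots> = exp (real (m i) * (lam * (C1 * p) + B * lam\<^sup>2 * V))"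
      by (simp add: exp_of_nat_mult)
    \<comment> \<open>The drift term no longer depends on the length, and the quadratic term
      decreases in it, so \<open>l \<le> m i\<close> gives one bound for all progressions.\<close>
    also have "real (m i) * (lam * (C1 * p) + B * lam\<^sup>2 * V) = \<mu> * (C1 * p) + B * \<mu>\<^sup>2 / real (m i) * V"
      using m0[of i] by (simp add: lam_def power2_eq_square field_simps)
    also have "exp \<dots> \<le> R"
      using lm[OF i] l B V by (auto simp: R_def intro!: mult_right_mono divide_left_mono)
    finally show ?thesis by (simp add: lam_def)
  qed
  have "(\<integral>\<omega>. exp (\<mu> * norm ((1 / real n) *\<^sub>R (\<Sum>i=1..n. X i \<omega>))) \<partial>M)
      \<le> (\<integral>\<omega>. (\<Sum>i=1..k. real (m i) / real n * (2 * cosh (\<mu> / real (m i) * norm (S i \<omega>)))) \<partial>M)"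
  proof (rule integral_mono')
    show "integrable M (\<lambda>\<omega>. \<Sum>i=1..k. real (m i) / real n * (2 * cosh (\<mu> / real (m i) * norm (S i \<omega>))))"
      by (intro Bochner_Integration.integrable_sum integrable_mult_right int)
    fix \<omega> assume \<omega>: "\<omega> \<in> space M"
    have "\<mu> * norm ((1 / real n) *\<^sub>R (\<Sum>i=1..n. X i \<omega>)) = \<mu> / real n * norm (\<Sum>i=1..k. S i \<omega>)"
      unfolding sum_S by simp
    also have "\<dots> \<le> \<mu> / real n * (\<Sum>i=1..k. norm (S i \<omega>))"
      using \<mu> by (intro mult_left_mono norm_sum) auto
    also have "\<dots> = (\<Sum>i=1..k. (real (m i) / real n) *\<^sub>R (\<mu> / real (m i) * norm (S i \<omega>)))"
      using m0 by (simp add: sum_distrib_left)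
    finally have "exp (\<mu> * norm ((1 / real n) *\<^sub>R (\<Sum>i=1..n. X i \<omega>)))
        \<le> exp (\<Sum>i=1..k. (real (m i) / real n) *\<^sub>R (\<mu> / real (m i) * norm (S i \<omega>)))" by simp
    \<comment> \<open>Jensen with the weights \<open>m i / n\<close>. The next step, exp \<le> 2
      cosh, is the origin of the 2 in front of the tail bound.\<close>
    also have "\<dots> \<le> (\<Sum>i=1..k. real (m i) / real n * exp (\<mu> / real (m i) * norm (S i \<omega>)))"
      using k n0 sum_m by (intro convex_on_sum[OF _ _ exp_convex]) (auto simp: sum_divide_distrib[symmetric])
    also have "\<dots> \<le> (\<Sum>i=1..k. real (m i) / real n * (2 * cosh (\<mu> / real (m i) * norm (S i \<omega>))))"
      by (intro sum_mono mult_left_mono) (auto simp: cosh_def)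
    finally show "exp (\<mu> * norm ((1 / real n) *\<^sub>R (\<Sum>i=1..n. X i \<omega>)))
        \<le> (\<Sum>i=1..k. real (m i) / real n * (2 * cosh (\<mu> / real (m i) * norm (S i \<omega>))))" .
  qed (auto intro!: sum_nonneg)
  also have "\<dots> = (\<Sum>i=1..k. real (m i) / real n * (2 * (\<integral>\<omega>. cosh (\<mu> / real (m i) * norm (S i \<omega>)) \<partial>M)))"
    using int by (subst Bochner_Integration.integral_sum) auto
  also have "\<dots> \<le> (\<Sum>i=1..k. real (m i) / real n * (2 * R))"
    by (intro sum_mono mult_left_mono block) auto
  also have "\<dots> = 2 * R" using n0
    by (simp only: sum_distrib_right[symmetric] sum_divide_distrib[symmetric] sum_m) simp
  finally show ?thesis by (simp add: R_def B_def V_def)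
qed

lemma norm_mean_tail:
  assumes lam: "lam \<ge> 0" "lam * c \<le> 1" and l: "l \<in> {1..n}"
    and p: "C_mixing_coeff M X Cset Csn (n div l) = ereal p"
    and le: "lam * (C1 * p) + (A1\<^sup>2 + A2) * lam\<^sup>2 * (\<sigma>\<^sup>2 + C2 * p) - lam * t \<le> - \<nu> / real l"
  shows "measure M {\<omega> \<in> space M. norm ((1 / real n) *\<^sub>R (\<Sum>i=1..n. X i \<omega>)) \<ge> t} \<le> 2 * exp (- \<nu>)"
proof -
  \<comment> \<open>With this \<mu> the Chernoff exponent is l times the left side of
    \<open>le\<close>, so \<nu> / l becomes \<nu>.\<close>
  define \<mu> where "\<mu> = real l * lam"
  have l0: "l > 0" using l by simp
  have \<mu>: "\<mu> \<ge> 0" "\<mu> / real l * c \<le> 1" using lam l0 by (simp_all add: \<mu>_def)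
  define Y where "Y \<omega> = norm ((1 / real n) *\<^sub>R (\<Sum>i=1..n. X i \<omega>))" for \<omega>
  have [measurable]: "(\<lambda>\<omega>. \<Sum>i=1..n. X i \<omega>) \<in> borel_measurable M"
    by (intro borel_measurable_sum meas) auto
  have [measurable]: "Y \<in> borel_measurable M" unfolding Y_def by measurable
  have Yc: "Y \<omega> \<le> c" if "\<omega> \<in> space M" for \<omega>
    using sum_norm_le[of "{1..n}" "\<lambda>i. X i \<omega>" "\<lambda>_. c"] vals that l by (simp add: Y_def field_simps)
  have int: "integrable M (\<lambda>\<omega>. exp (\<mu> * Y \<omega>))"
    using Yc \<mu>(1) by (intro integrable_const_bound[where B="exp (\<mu> * c)"]) (auto intro!: AE_I2 mult_left_mono)
  have "measure M {\<omega> \<in> space M. Y \<omega> \<ge> t} \<le> measure M {\<omega> \<in> space M. exp (\<mu> * Y \<omega>) \<ge> exp (\<mu> * t)}"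
    using \<mu>(1) by (intro finite_measure_mono) (auto intro: mult_left_mono)
  also have "\<dots> \<le> (\<integral>\<omega>. exp (\<mu> * Y \<omega>) \<partial>M) / exp (\<mu> * t)"
    by (rule integral_Markov_inequality_measure[OF int sets.top]) auto
  also have "\<dots> \<le> 2 * exp (\<mu> * (C1 * p) + (A1\<^sup>2 + A2) * \<mu>\<^sup>2 / real l * (\<sigma>\<^sup>2 + C2 * p)) / exp (\<mu> * t)"
    by (intro divide_right_mono exp_norm_mean_bound[OF \<mu> l p, folded Y_def]) auto
  also have "\<dots> = 2 * exp (\<mu> * (C1 * p) + (A1\<^sup>2 + A2) * \<mu>\<^sup>2 / real l * (\<sigma>\<^sup>2 + C2 * p) - \<mu> * t)"
    by (simp only: exp_diff times_divide_eq_right)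
  also have "\<mu> * (C1 * p) + (A1\<^sup>2 + A2) * \<mu>\<^sup>2 / real l * (\<sigma>\<^sup>2 + C2 * p) - \<mu> * t
      = real l * (lam * (C1 * p) + (A1\<^sup>2 + A2) * lam\<^sup>2 * (\<sigma>\<^sup>2 + C2 * p) - lam * t)"
    using l0 by (simp add: \<mu>_def power2_eq_square field_simps)
  also have "2 * exp (real l * (lam * (C1 * p) + (A1\<^sup>2 + A2) * lam\<^sup>2 * (\<sigma>\<^sup>2 + C2 * p) - lam * t)) \<le> 2 * exp (- \<nu>)"
    using mult_left_mono[OF le, of "real l"] l0 by simp
  finally show ?thesis by (simp only: Y_def)
qed

end

section \<open>The effective sample size and the final bound\<close>

text \<open>The index 1 is in the set by fiat, so a maximum equal to 1 carries no information on the
  mixing coefficient.\<close>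

lemma eff_sample_size_cases:
  assumes "n \<ge> 1"
  obtains "eff_sample_size n C1 c \<sigma> Phi = 1"
  | l where "eff_sample_size n C1 c \<sigma> Phi = l" "l \<in> {1..n}"
    "ereal C1 * Phi (n div l) \<le> ereal (max (c / real l) (\<sigma> / sqrt (real l)))"
proof -
  let ?A = "{l \<in> {1..n}. ereal C1 * Phi (n div l) \<le> ereal (max (c / real l) (\<sigma> / sqrt (real l)))} \<union> {1}"
  have "Max ?A \<in> ?A" by (intro Max_in) auto
  then show thesis using that unfolding eff_sample_size_def by blast
qed

theorem theorem3p2:
  fixes M :: "'w measure"
    and X :: "nat \<Rightarrow> 'w \<Rightarrow> 'a::{banach, second_countable_topology}"
    and Cset :: "('a \<Rightarrow> real) set" and Csn :: "('a \<Rightarrow> real) \<Rightarrow> real"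
    and c \<sigma> A1 A2 C1 C2 :: real and n :: nat
  assumes "prob_space M"
    and meas: "\<And>i. i \<ge> 1 \<Longrightarrow> X i \<in> borel_measurable M"
    and vals: "\<And>i \<omega>. i \<ge> 1 \<Longrightarrow> \<omega> \<in> space M \<Longrightarrow> X i \<omega> \<in> cball 0 c"
    and centered: "\<And>i. i \<ge> 1 \<Longrightarrow> integral\<^sup>L M (X i) = 0"
    and mixcls: "mixing_class c Cset Csn"
    and A1: "assumption_A1 TYPE('a) A1 A2"
    and A2: "c > 0" "\<sigma> > 0" "\<And>i. i \<ge> 1 \<Longrightarrow> integral\<^sup>L M (\<lambda>\<omega>. (norm (X i \<omega>))\<^sup>2) \<le> \<sigma>\<^sup>2"
    and A3: "\<And>s::'a \<Rightarrow>\<^sub>L real. restr_ball c (blinfun_apply s) \<in> Cset"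
            "restr_ball c (\<lambda>x. (norm x)\<^sup>2) \<in> Cset"
            "\<And>s::'a \<Rightarrow>\<^sub>L real. norm s \<le> 1 \<Longrightarrow> Csn (restr_ball c (blinfun_apply s)) \<le> C1"
            "Csn (restr_ball c (\<lambda>x. (norm x)\<^sup>2)) \<le> C2" "C1 > 0" "C2 \<ge> 0"
    and "n \<ge> 1"
  shows "\<forall>\<nu>::real. \<nu> \<ge> 1 \<longrightarrow>
    (let l = real (eff_sample_size n C1 c \<sigma> (C_mixing_coeff M X Cset Csn));
         B = A1\<^sup>2 + A2;
         M1 = 2 + 2 * sqrt B * (1 + 2 * C2 / (C1 * c))
     in measure M {\<omega> \<in> space M.
          norm ((1 / real n) *\<^sub>R (\<Sum>i=1..n. X i \<omega>))
            \<ge> \<sigma> * (4 * A1 + 6 * sqrt B * sqrt \<nu>) / sqrt l + c * (4 * A1 + M1 * \<nu>) / l}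
        \<le> 2 * exp (- \<nu>))"
proof (intro allI impI)
  fix \<nu> :: real assume \<nu>: "\<nu> \<ge> 1"
  interpret prob_space M by fact
  interpret centered_C_mixing_process M X Cset Csn c \<sigma> A1 A2 C1 C2
    by unfold_locales (use assms in \<open>simp_all\<close>)
  have A: "A1 \<ge> 1" "A2 > 0" using A1 by (auto simp: assumption_A1_def)
  define B where "B = A1\<^sup>2 + A2"
  define D where "D = C2 / (C1 * c)"
  have D: "D \<ge> 0" and B: "B > 0" using A2 A3 A by (auto simp: D_def B_def intro: add_nonneg_pos)
  let ?Phi = "C_mixing_coeff M X Cset Csn"
  let ?Y = "\<lambda>\<omega>. norm ((1 / real n) *\<^sub>R (\<Sum>i=1..n. X i \<omega>))"
  let ?t = "\<lambda>l. \<sigma> * (4 * A1 + 6 * sqrt B * sqrt \<nu>) / sqrt l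
        + c * (4 * A1 + (2 + 2 * sqrt B * (1 + 2 * D)) * \<nu>) / l"
  have "measure M {\<omega> \<in> space M. ?t (real (eff_sample_size n C1 c \<sigma> ?Phi)) \<le> ?Y \<omega>} \<le> 2 * exp (- \<nu>)"
  proof (cases rule: eff_sample_size_cases[OF \<open>n \<ge> 1\<close>, where Phi="?Phi" and ?C1.0=C1 and c=c and \<sigma>=\<sigma>])
    case 1
    \<comment> \<open>With A1 \<ge> 1 the threshold at l = 1 exceeds c, whereas the mean has norm at
      most c: the event is empty.\<close>
    have "c * 1 < c * (4 * A1 + (2 + 2 * sqrt B * (1 + 2 * D)) * \<nu>)"
    proof (rule mult_strict_left_mono)
      have "0 \<le> (2 + 2 * sqrt B * (1 + 2 * D)) * \<nu>" using B D \<nu> by simp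
      then show "1 < 4 * A1 + (2 + 2 * sqrt B * (1 + 2 * D)) * \<nu>" using A by linarith
    qed (use A2 in simp)
    moreover have "0 \<le> \<sigma> * (4 * A1 + 6 * sqrt B * sqrt \<nu>)" using A2 A B \<nu> by simp
    ultimately have t: "c < ?t 1" by simp
    have "?Y \<omega> \<le> c" if "\<omega> \<in> space M" for \<omega>
      using sum_norm_le[of "{1..n}" "\<lambda>i. X i \<omega>" "\<lambda>_. c"] vals that \<open>n \<ge> 1\<close> by (simp add: field_simps)
    then have "{\<omega> \<in> space M. ?t 1 \<le> ?Y \<omega>} = {}" using t by force
    then show ?thesis by (simp only: 1 of_nat_1) simp
  next
    case (2 l)
    \<comment> \<open>The defining inequality forces the coefficient to be finite, because C1 > 0;
      only then is there a real p.\<close>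
    have "ereal C1 * ?Phi (n div l) < \<infinity>" by (rule order.strict_trans1[OF 2(3)]) (simp only: less_ereal.simps)
    then have "?Phi (n div l) \<noteq> \<infinity>" using A3(5) by auto
    then obtain p where p: "?Phi (n div l) = ereal p"
      using mixing_coeff_nonneg[of "n div l"] by (cases "?Phi (n div l)") auto
    have p0: "p \<ge> 0" using mixing_coeff_nonneg[of "n div l"] p by simp
    have Dc: "D * c * (C1 * p) = C2 * p" using A2 A3(5) by (simp add: D_def)
    have "C1 * p \<le> max (c / real l) (\<sigma> / sqrt (real l))"
      using 2(3) unfolding p by (simp only: times_ereal.simps ereal_less_eq)
    moreover have "0 \<le> C1 * p" "1 \<le> real l" using A3(5) p0 2(2) by auto
    ultimately obtain lam where "lam \<ge> 0" "lam * c \<le> 1"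
      "lam * (C1 * p) + B * lam\<^sup>2 * (\<sigma>\<^sup>2 + D * c * (C1 * p)) - lam * ?t (real l) \<le> - \<nu> / real l"
      using bernstein_parameter[OF A2(1,2) \<nu> _ A(1) B D] by blast
    with norm_mean_tail[OF _ _ 2(2) p, folded B_def Dc] show ?thesis unfolding 2(1) by blast
  qed
  then show "let l = real (eff_sample_size n C1 c \<sigma> ?Phi); B = A1\<^sup>2 + A2;
         M1 = 2 + 2 * sqrt B * (1 + 2 * C2 / (C1 * c))
     in measure M {\<omega> \<in> space M. ?Y \<omega>
            \<ge> \<sigma> * (4 * A1 + 6 * sqrt B * sqrt \<nu>) / sqrt l + c * (4 * A1 + M1 * \<nu>) / l}
        \<le> 2 * exp (- \<nu>)"
    by (simp add: Let_def B_def D_def)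
qed

end
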